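(* Let $(\Phi,G)$ be a perception pair, $k\in\mathbb{N}$, and consider GENEOs from $(\Phi,G)$ to $(\Phi,G)$ associated with the identity homomorphism $T=\mathrm{id}:G\to G$; let $\mathcal{F}^{\mathrm{all}}$ be the set of all of them. Assume that every function in $\Phi$ is non-negative, that the $k$-th Betti number of $X$ (Čech homology, topology induced by $D_X$) is nonzero, and that $\Phi$ contains every constant function $c$ for which there exists $\varphi\in\Phi$ with $0\le c\le\|\varphi\|_\infty$. Then $\mathcal{D}^{\mathcal{F}^{\mathrm{all}},k}_{\mathrm{match}}(\varphi_1,\varphi_2)=d_G(\varphi_1,\varphi_2)$ for all $\varphi_1,\varphi_2\in\Phi$.
   Context: A perception pair $(\Phi,G)$ consists of: a nonempty set $X$; a nonempty set $\Phi$ of bounded functions $X\to\mathbb{R}$, compact with respect to $D_\Phi(\varphi_1,\varphi_2):=\|\varphi_1-\varphi_2\|_\infty$, such that $X$ is complete with respect to $D_X(x_1,x_2):=\sup_{\varphi\in\Phi}|\varphi(x_1)-\varphi(x_2)|$; and a subgroup $G$ of $\mathrm{Homeo}_\Phi(X)$ (bijections $g:X\to X$, homeomorphisms for $D_X$, with $\varphi\circ g,\varphi\circ g^{-1}\in\Phi$ for all $\varphi\in\Phi$) that is complete with respect to $D_G(g_1,g_2):=\sup_{\varphi\in\Phi}D_\Phi(\varphi\circ g_1,\varphi\circ g_2)$. Natural pseudo-distance: $d_G(\varphi_1,\varphi_2):=\inf_{g\in G}D_\Phi(\varphi_1,\varphi_2\circ g)$. A GENEO from $(\Phi,G)$ to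 $(\Phi,G)$ associated with $\mathrm{id}$ is a map $F:\Phi\to\Phi$ with $F(\varphi\circ g)=F(\varphi)\circ g$ and $D_\Phi(F(\varphi_1),F(\varphi_2))\le D_\Phi(\varphi_1,\varphi_2)$. Persistent homology: for $\psi\in\Phi$ and $u<v$, with $X_t=\psi^{-1}((-\infty,t])$, $r_k(\psi)(u,v)$ is the rank of the image of $\check H_k(X_u)\to\check H_k(X_v)$ (Čech homology); standing assumption: these are finite. $d_{\mathrm{match}}$ is the bottleneck distance between the associated persistence diagrams ($\inf$ over bijections $\sigma$ of $\sup_p d^*(p,\sigma(p))$, diagonal points with infinite multiplicity, $d^*((x,y),(x',y'))=\min\{\max\{|x-x'|,|y-y'|\},\max\{\frac{y-x}{2},\frac{y'-x'}{2}\}\}$, points at infinity at distance $|x-x'|$ from each other). $\mathcal{D}^{\mathcal{F},k}_{\mathrm{match}}(\varphi_1,\varphi_2):=\sup_{F\in\mathcal{F}}d_{\mathrm{match}}(r_k(F(\varphi_1)),r_k(F(\varphi_2)))$. *)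

theory Defs
  imports "HOL-Analysis.Analysis" "HOL-Library.Extended_Nat" "HOL-Library.Extended_Real"
begin

text \<open>The set X is represented by the (nonempty) type 'x; X = UNIV.\<close>

definition DPhi :: "('x \<Rightarrow> real) \<Rightarrow> ('x \<Rightarrow> real) \<Rightarrow> real" where
  "DPhi f g = (SUP x. \<bar>f x - g x\<bar>)"

definition supnorm :: "('x \<Rightarrow> real) \<Rightarrow> real" where
  "supnorm f = (SUP x. \<bar>f x\<bar>)"

definition DX :: "('x \<Rightarrow> real) set \<Rightarrow> 'x \<Rightarrow> 'x \<Rightarrow> real" where
  "DX Phi x y = (SUP phi\<in>Phi. \<bar>phi x - phi y\<bar>)"

definition DG :: "('x \<Rightarrow> real) set \<Rightarrow> ('x \<Rightarrow> 'x) \<Rightarrow> ('x \<Rightarrow> 'x) \<Rightarrow> real" where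
  "DG Phi g1 g2 = (SUP phi\<in>Phi. DPhi (phi \<circ> g1) (phi \<circ> g2))"

definition DX_continuous :: "('x \<Rightarrow> real) set \<Rightarrow> ('x \<Rightarrow> 'x) \<Rightarrow> bool" where
  "DX_continuous Phi g =
     (\<forall>x. \<forall>e>0. \<exists>d>0. \<forall>y. DX Phi x y < d \<longrightarrow> DX Phi (g x) (g y) < e)"

definition Homeo_Phi :: "('x \<Rightarrow> real) set \<Rightarrow> ('x \<Rightarrow> 'x) \<Rightarrow> bool" where
  "Homeo_Phi Phi g =
     (bij g \<and> DX_continuous Phi g \<and> DX_continuous Phi (inv g) \<and>
      (\<forall>phi\<in>Phi. phi \<circ> g \<in> Phi \<and> phi \<circ> inv g \<in> Phi))"

text \<open>Compactness of Phi w.r.t. the sup distance, written as sequential compactness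
  (equivalent for (pseudo)metric spaces).\<close>
definition Phi_compact :: "('x \<Rightarrow> real) set \<Rightarrow> bool" where
  "Phi_compact Phi =
     (\<forall>s::nat \<Rightarrow> ('x \<Rightarrow> real). (\<forall>n. s n \<in> Phi) \<longrightarrow>
        (\<exists>r phi. strict_mono r \<and> phi \<in> Phi \<and> (\<lambda>n. DPhi (s (r n)) phi) \<longlonglongrightarrow> 0))"

definition X_complete :: "('x \<Rightarrow> real) set \<Rightarrow> bool" where
  "X_complete Phi =
     (\<forall>s::nat \<Rightarrow> 'x. (\<forall>e>0. \<exists>N. \<forall>m\<ge>N. \<forall>n\<ge>N. DX Phi (s m) (s n) < e) \<longrightarrow>
        (\<exists>x. (\<lambda>n. DX Phi (s n) x) \<longlonglongrightarrow> 0))"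

definition G_complete :: "('x \<Rightarrow> real) set \<Rightarrow> ('x \<Rightarrow> 'x) set \<Rightarrow> bool" where
  "G_complete Phi G =
     (\<forall>s::nat \<Rightarrow> ('x \<Rightarrow> 'x). (\<forall>n. s n \<in> G) \<longrightarrow>
        (\<forall>e>0. \<exists>N. \<forall>m\<ge>N. \<forall>n\<ge>N. DG Phi (s m) (s n) < e) \<longrightarrow>
        (\<exists>g\<in>G. (\<lambda>n. DG Phi (s n) g) \<longlonglongrightarrow> 0))"

definition perception_pair :: "('x \<Rightarrow> real) set \<Rightarrow> ('x \<Rightarrow> 'x) set \<Rightarrow> bool" where
  "perception_pair Phi G =
     (Phi \<noteq> {} \<and> (\<forall>phi\<in>Phi. bounded (range phi)) \<and> Phi_compact Phi \<and> X_complete Phi \<and>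
      (\<forall>g\<in>G. Homeo_Phi Phi g) \<and> id \<in> G \<and> (\<forall>g\<in>G. \<forall>h\<in>G. g \<circ> h \<in> G) \<and>
      (\<forall>g\<in>G. inv g \<in> G) \<and> G_complete Phi G)"

definition dG :: "('x \<Rightarrow> real) set \<Rightarrow> ('x \<Rightarrow> 'x) set \<Rightarrow> ('x \<Rightarrow> real) \<Rightarrow> ('x \<Rightarrow> real) \<Rightarrow> real" where
  "dG Phi G phi1 phi2 = (INF g\<in>G. DPhi phi1 (phi2 \<circ> g))"

definition GENEO :: "('x \<Rightarrow> real) set \<Rightarrow> ('x \<Rightarrow> 'x) set \<Rightarrow>
     (('x \<Rightarrow> real) \<Rightarrow> ('x \<Rightarrow> real)) \<Rightarrow> bool" where
  "GENEO Phi G F =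
     ((\<forall>phi\<in>Phi. F phi \<in> Phi) \<and>
      (\<forall>phi\<in>Phi. \<forall>g\<in>G. F (phi \<circ> g) = F phi \<circ> g) \<and>
      (\<forall>phi1\<in>Phi. \<forall>phi2\<in>Phi. DPhi (F phi1) (F phi2) \<le> DPhi phi1 phi2))"

text \<open>Topology on X induced by the pseudo-distance D_X.  Open covers of a subspace Y
  are families of D_X-open subsets of X whose union contains Y (their traces on Y
  are the open sets of the cover of Y).  Simplicial homology of the nerve is
  computed with ordered simplices.\<close>

definition DXopen :: "('x \<Rightarrow> real) set \<Rightarrow> 'x set \<Rightarrow> bool" where
  "DXopen Phi S = (\<forall>x\<in>S. \<exists>e>0. \<forall>y. DX Phi x y < e \<longrightarrow> y \<in> S)"

definition open_cover :: "('x \<Rightarrow> real) set \<Rightarrow> 'x set \<Rightarrow> 'x set set \<Rightarrow> bool" where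
  "open_cover Phi Y U = ((\<forall>A\<in>U. DXopen Phi A) \<and> Y \<subseteq> \<Union>U)"

definition nerve_simplex :: "'x set \<Rightarrow> 'x set set \<Rightarrow> nat \<Rightarrow> 'x set list \<Rightarrow> bool" where
  "nerve_simplex Y U k s = (length s = Suc k \<and> set s \<subseteq> U \<and> Y \<inter> \<Inter>(set s) \<noteq> {})"

definition is_chain :: "'x set \<Rightarrow> 'x set set \<Rightarrow> nat \<Rightarrow> ('x set list \<Rightarrow> 'k::field) \<Rightarrow> bool" where
  "is_chain Y U k c = (finite {s. c s \<noteq> 0} \<and> (\<forall>s. c s \<noteq> 0 \<longrightarrow> nerve_simplex Y U k s))"

definition bd :: "('x set list \<Rightarrow> 'k::field) \<Rightarrow> ('x set list \<Rightarrow> 'k)" where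
  "bd c = (\<lambda>t. \<Sum>s\<in>{s. c s \<noteq> 0}. \<Sum>i<length s.
              if take i s @ drop (Suc i) s = t then (-1) ^ i * c s else 0)"

definition is_cycle :: "'x set \<Rightarrow> 'x set set \<Rightarrow> nat \<Rightarrow> ('x set list \<Rightarrow> 'k::field) \<Rightarrow> bool" where
  "is_cycle Y U k c = (is_chain Y U k c \<and> (0 < k \<longrightarrow> bd c = (\<lambda>_. 0)))"

definition homologous :: "'x set \<Rightarrow> 'x set set \<Rightarrow> nat \<Rightarrow>
     ('x set list \<Rightarrow> 'k::field) \<Rightarrow> ('x set list \<Rightarrow> 'k) \<Rightarrow> bool" where
  "homologous Y U k c c' = (\<exists>d. is_chain Y U (Suc k) d \<and> (\<lambda>s. c s - c' s) = bd d)"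

definition push :: "('x set \<Rightarrow> 'x set) \<Rightarrow> ('x set list \<Rightarrow> 'k::field) \<Rightarrow> ('x set list \<Rightarrow> 'k)" where
  "push lam c = (\<lambda>t. \<Sum>s\<in>{s. c s \<noteq> 0}. if map lam s = t then c s else 0)"

definition refinement_map :: "'x set set \<Rightarrow> 'x set set \<Rightarrow> ('x set \<Rightarrow> 'x set) \<Rightarrow> bool" where
  "refinement_map V U lam = (\<forall>A\<in>V. lam A \<in> U \<and> A \<subseteq> lam A)"

text \<open>An element of the Cech homology group H_k(Y) (the inverse limit over open covers)
  is represented by a compatible family of cycle representatives, one per cover.\<close>
definition cech_elem :: "('x \<Rightarrow> real) set \<Rightarrow> 'x set \<Rightarrow> nat \<Rightarrow>
     ('x set set \<Rightarrow> 'x set list \<Rightarrow> 'k::field) \<Rightarrow> bool" where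
  "cech_elem Phi Y k h =
     ((\<forall>U. open_cover Phi Y U \<longrightarrow> is_cycle Y U k (h U)) \<and>
      (\<forall>U V lam. open_cover Phi Y U \<longrightarrow> open_cover Phi Y V \<longrightarrow> refinement_map V U lam \<longrightarrow>
          homologous Y U k (push lam (h V)) (h U)))"

text \<open>Rank of the image of the map H_k(Y) \<rightarrow> H_k(Y') induced by inclusion (Y \<subseteq> Y'):
  the supremum of the sizes of families in H_k(Y) whose images are linearly independent.\<close>
definition cech_image_rank :: "'k::field itself \<Rightarrow> ('x \<Rightarrow> real) set \<Rightarrow> nat \<Rightarrow>
     'x set \<Rightarrow> 'x set \<Rightarrow> enat" where
  "cech_image_rank TK Phi k Y Y' =
     Sup {enat n | n. \<exists>hs :: nat \<Rightarrow> 'x set set \<Rightarrow> 'x set list \<Rightarrow> 'k.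
        (\<forall>i<n. cech_elem Phi Y k (hs i)) \<and>
        (\<forall>c. (\<forall>U. open_cover Phi Y' U \<longrightarrow>
                   homologous Y' U k (\<lambda>s. \<Sum>i<n. c i * hs i U s) (\<lambda>_. 0))
             \<longrightarrow> (\<forall>i<n. c i = 0))}"

text \<open>Persistent Betti numbers r_k(psi)(u,v), u < v (finite by the standing assumption).\<close>
definition pers_rank :: "'k::field itself \<Rightarrow> ('x \<Rightarrow> real) set \<Rightarrow> nat \<Rightarrow>
     ('x \<Rightarrow> real) \<Rightarrow> real \<Rightarrow> real \<Rightarrow> nat" where
  "pers_rank TK Phi k psi u v =
     the_enat (cech_image_rank TK Phi k {x. psi x \<le> u} {x. psi x \<le> v})"

definition mult_proper :: "(real \<Rightarrow> real \<Rightarrow> nat) \<Rightarrow> real \<Rightarrow> real \<Rightarrow> nat" where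
  "mult_proper r u v = nat (Inf {int (r (u+e) (v-e)) - int (r (u-e) (v-e))
        - int (r (u+e) (v+e)) + int (r (u-e) (v+e)) | e. 0 < e \<and> u + e < v - e})"

definition mult_inf :: "(real \<Rightarrow> real \<Rightarrow> nat) \<Rightarrow> real \<Rightarrow> nat" where
  "mult_inf r u = nat (Inf {int (r (u+e) v) - int (r (u-e) v) | e v. 0 < e \<and> u + e < v})"

definition diagram :: "(real \<Rightarrow> real \<Rightarrow> nat) \<Rightarrow> real \<times> ereal \<Rightarrow> nat" where
  "diagram r p = (case p of
       (u, ereal v) \<Rightarrow> (if u < v then mult_proper r u v else 0)
     | (u, PInfty) \<Rightarrow> mult_inf r u
     | (u, MInfty) \<Rightarrow> 0)"

text \<open>Points of a diagram with multiplicities (labelled by copies), together with all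
  diagonal points with infinite multiplicity.\<close>
definition aug :: "(real \<times> ereal \<Rightarrow> nat) \<Rightarrow> ((real \<times> ereal) \<times> nat) set" where
  "aug m = {((u, w), i). (ereal u < w \<and> i < m (u, w)) \<or> w = ereal u}"

definition dstar :: "real \<times> ereal \<Rightarrow> real \<times> ereal \<Rightarrow> ereal" where
  "dstar p q = (case (p, q) of
       ((x, ereal y), (x', ereal y')) \<Rightarrow>
          ereal (min (max \<bar>x - x'\<bar> \<bar>y - y'\<bar>) (max ((y - x) / 2) ((y' - x') / 2)))
     | ((x, PInfty), (x', PInfty)) \<Rightarrow> ereal \<bar>x - x'\<bar>
     | _ \<Rightarrow> \<infinity>)"

definition dmatch :: "(real \<times> ereal \<Rightarrow> nat) \<Rightarrow> (real \<times> ereal \<Rightarrow> nat) \<Rightarrow> ereal" where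
  "dmatch m1 m2 = (INF sigma\<in>{sigma. bij_betw sigma (aug m1) (aug m2)}.
        SUP a\<in>aug m1. dstar (fst a) (fst (sigma a)))"

definition Dmatch_all :: "'k::field itself \<Rightarrow> ('x \<Rightarrow> real) set \<Rightarrow> ('x \<Rightarrow> 'x) set \<Rightarrow> nat \<Rightarrow>
     ('x \<Rightarrow> real) \<Rightarrow> ('x \<Rightarrow> real) \<Rightarrow> ereal" where
  "Dmatch_all TK Phi G k phi1 phi2 =
     (SUP F\<in>{F. GENEO Phi G F}.
        dmatch (diagram (pers_rank TK Phi k (F phi1))) (diagram (pers_rank TK Phi k (F phi2))))"

end

(* Lower bound: psi |-> the constant function d_G(psi, phi2) is a GENEO, and the persistence diagram
   of a constant c consists of the point (c, infinity), so this operator alone realises d_G.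

   Upper bound: ranks are invariant under the homeomorphisms in G, so it suffices to prove that
   diagrams are stable under sup-norm perturbation. The Cech persistence module of psi is
   Z_t / (Z_t \<inter> N_t) for two increasing families of subspaces of one fixed vector space, and
   functions at sup-distance \<epsilon> give families that are \<epsilon>-interleaved by plain inclusions.
   On finitely many times Z and N have a common adapted basis, whose elements are the bars. For the
   adapted bases of two interleaved modules the transition matrices are mutually inverse, and their
   nonzero entries are constrained by births and deaths; ordering the bars by birth + death, a
   triangularity argument yields Hall's condition for matching bars at distance at most \<epsilon>.
   Refining the times transfers this to the points of the diagrams. Hall's theorem gives matchings of
   the points far from the diagonal in both directions, and Schroeder-Bernstein combines them into
   one bijection. *)

theory Submission
  imports Defs "HOL-Library.Function_Algebras"
begin

section \<open>Adapted bases of two flags\<close>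

text \<open>The spaces \<open>Z t\<close> and \<open>N t\<close> of Cech families need not have
  finite dimension; only the ranks of \<open>Z u\<close> modulo \<open>N v\<close> with
  \<open>u < v\<close> are known to be finite. So no bar decomposition over all real times is
  sought. A basis adapted to finitely many times exists in any dimension, and only bars alive across
  some gap \<open>u < v\<close> are counted: these are finitely many, and the ranks alone determine
  their numbers. The price is that multiplicities are limits of box counts, while a sampled basis
  knows births and deaths only up to the mesh. This is why stability is stated with a slack
  \<open>\<epsilon> < \<eta>\<close>, absorbed at the end by an arbitrarily small error. Comparing
  the two functions directly, through inclusions, also avoids interpolating between them:
  intermediate functions need not lie in \<open>Phi\<close>, so their ranks need not be finite. In
  the lower bound the operator takes constant values because constants are unchanged by every
  \<open>g\<close> in \<open>G\<close>; its equivariance thereby reduces to the invariance of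
  \<open>dG\<close> in the first argument.\<close>

no_notation vector_scalar_mult (infixl "*s" 70)

text \<open>Serves indexed families, which may repeat a vector although a set cannot. Two equal
  members give the relation with coefficients 1 and -1; otherwise the image is a set too large to be
  independent in the span of \<open>T\<close>.\<close>

lemma (in vector_space) dependent_family:
  assumes fin: "finite I" "finite T" and card: "card T < card I"
    and w: "\<And>i. i \<in> I \<Longrightarrow> w i \<in> span T"
  obtains c where "(\<Sum>i\<in>I. c i *s w i) = 0" "\<exists>i\<in>I. c i \<noteq> 0"
proof (cases "inj_on w I")
  case True
  have "dependent (w ` I)"
  proof (rule ccontr)
    assume "\<not> dependent (w ` I)"
    then have "card (w ` I) \<le> card T"
      using independent_span_bound[OF fin(2)] w by blast
    with card show False by (simp add: card_image[OF True])
  qed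
  then obtain u where u: "\<exists>v\<in>w ` I. u v \<noteq> 0" "(\<Sum>v\<in>w ` I. u v *s v) = 0"
    using fin(1) by (auto simp: dependent_finite)
  show ?thesis
    by (rule that[of "u \<circ> w"]) (use u in \<open>auto simp: sum.reindex[OF True]\<close>)
next
  case False
  then obtain i j where ij: "i \<in> I" "j \<in> I" "i \<noteq> j" "w i = w j"
    by (auto simp: inj_on_def)
  define c where "c l = (if l = i then 1 else if l = j then - 1 else (0::'a))" for l
  have "(\<Sum>l\<in>I. c l *s w l) = (\<Sum>l\<in>{i, j}. c l *s w l)"
    by (rule sum.mono_neutral_right) (use fin ij in \<open>auto simp: c_def\<close>)
  also have "\<dots> = 0"
    using ij by (simp add: c_def scale_minus_left)
  finally have "(\<Sum>l\<in>I. c l *s w l) = 0" .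
  moreover have "c i \<noteq> 0" by (simp add: c_def)
  ultimately show ?thesis using that ij(1) by blast
qed

text \<open>For subspaces, the dimension of \<open>Z\<close> modulo \<open>Z \<inter> N\<close>. The
  form copies \<open>cech_image_rank\<close>, so that the two agree by unfolding.\<close>

definition (in vector_space) quot_rank :: "'b set \<Rightarrow> 'b set \<Rightarrow> enat" where
  "quot_rank Z N = Sup {enat n | n. \<exists>hs :: nat \<Rightarrow> 'b.
     (\<forall>i<n. hs i \<in> Z) \<and> (\<forall>c. (\<Sum>i<n. c i *s hs i) \<in> N \<longrightarrow> (\<forall>i<n. c i = 0))}"

text \<open>The coordinates of \<open>x\<close> with respect to \<open>B\<close> are supported in
  \<open>F\<close> and in \<open>G\<close>, hence nowhere.\<close>

lemma (in vector_space) span_Int_disjoint: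
  assumes B: "independent B" and FG: "F \<subseteq> B" "G \<subseteq> B" "F \<inter> G = {}"
    and x: "x \<in> span F" "x \<in> span G"
  shows "x = 0"
proof -
  have r: "representation B x = representation F x" "representation B x = representation G x"
    using representation_extend[OF B x(1) FG(1)] representation_extend[OF B x(2) FG(2)] .
  have "representation B x b = 0" for b
    using r FG(3) representation_ne_zero[of F x b] representation_ne_zero[of G x b]
    by (metis disjoint_iff)
  then show ?thesis
    using sum_nonzero_representation_eq[OF B, of x] x(1) span_mono[OF FG(1)] by auto
qed

text \<open>The members of \<open>B\<close> in \<open>Z\<close> but outside \<open>N\<close> form a
  basis of \<open>Z\<close> modulo \<open>N\<close>: a combination of them lying in \<open>N\<close>
  lies in the spans of two disjoint parts of \<open>B\<close>, and a larger family becomes dependent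
  once its components in \<open>N\<close> are dropped.\<close>

lemma (in vector_space) quot_rank_adapted:
  assumes B: "independent B" and Z: "span (B \<inter> Z) = Z" and N: "span (B \<inter> N) = N"
    and fin: "quot_rank Z N \<noteq> \<infinity>"
  shows "finite ((B \<inter> Z) - N) \<and> quot_rank Z N = enat (card ((B \<inter> Z) - N))"
proof -
  have lower: "enat (card F) \<le> quot_rank Z N" if F: "finite F" "F \<subseteq> (B \<inter> Z) - N" for F
  proof -
    obtain h where h: "bij_betw h {0..<card F} F"
      using ex_bij_betw_nat_finite[OF F(1)] by blast
    have inj: "inj_on h {..<card F}" and im: "h ` {..<card F} = F"
      using h by (auto simp: bij_betw_def atLeast0LessThan)
    have "\<forall>i<card F. c i = 0" if c: "(\<Sum>i<card F. c i *s h i) \<in> N" for c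
    proof -
      define u where "u = c \<circ> the_inv_into {..<card F} h"
      have uh: "u (h i) = c i" if "i < card F" for i
        using that inj by (simp add: u_def the_inv_into_f_f)
      have "(\<Sum>i<card F. c i *s h i) = (\<Sum>i<card F. u (h i) *s h i)"
        by (intro sum.cong) (auto simp: uh)
      also have "\<dots> = (\<Sum>v\<in>F. u v *s v)"
        using sum.reindex[OF inj, of "\<lambda>v. u v *s v"] im by (simp add: o_def)
      finally have e: "(\<Sum>i<card F. c i *s h i) = (\<Sum>v\<in>F. u v *s v)" .
      have "(\<Sum>v\<in>F. u v *s v) = 0"
      proof (rule span_Int_disjoint[OF B, of F "B \<inter> N"])
        show "(\<Sum>v\<in>F. u v *s v) \<in> span F"
          by (intro span_sum span_scale span_base)
      qed (use F c e N in auto)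
      then have "\<forall>v\<in>F. u v = 0"
        using independentD[OF B F(1)] F(2) by blast
      then show ?thesis using uh im by force
    qed
    then show ?thesis
      unfolding quot_rank_def using F im by (intro Sup_upper) blast
  qed
  have fT: "finite ((B \<inter> Z) - N)"
  proof (rule ccontr)
    assume inf: "infinite ((B \<inter> Z) - N)"
    obtain m where m: "quot_rank Z N = enat m" using fin by auto
    obtain F where "finite F" "F \<subseteq> (B \<inter> Z) - N" "card F = Suc m"
      using infinite_arbitrarily_large[OF inf] by blast
    with lower[of F] m show False by simp
  qed
  define T where "T = (B \<inter> Z) - N"
  have "quot_rank Z N \<le> enat (card T)"
    unfolding quot_rank_def
  proof (rule Sup_least, clarify)
    fix n and hs :: "nat \<Rightarrow> 'b"
    assume hs: "\<forall>i<n. hs i \<in> Z"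
      and ind: "\<forall>c. (\<Sum>i<n. c i *s hs i) \<in> N \<longrightarrow> (\<forall>i<n. c i = 0)"
    show "enat n \<le> enat (card T)"
    proof (rule ccontr)
      assume "\<not> enat n \<le> enat (card T)"
      then have less: "card T < card {..<n}" by simp
      have "\<exists>w y. hs i = w + y \<and> w \<in> span T \<and> y \<in> span (B \<inter> N)" if "i < n" for i
      proof -
        have "hs i \<in> span (T \<union> (B \<inter> N))"
          using hs that Z span_mono[of "B \<inter> Z" "T \<union> (B \<inter> N)"] by (auto simp: T_def)
        then show ?thesis unfolding span_Un by blast
      qed
      then obtain w y where wy: "\<And>i. i < n \<Longrightarrow> hs i = w i + y i"
        "\<And>i. i < n \<Longrightarrow> w i \<in> span T" "\<And>i. i < n \<Longrightarrow> y i \<in> span (B \<inter> N)"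
        by metis
      obtain c where c: "(\<Sum>i<n. c i *s w i) = 0" "\<exists>i\<in>{..<n}. c i \<noteq> 0"
        using dependent_family[OF _ _ less, of w] fT wy(2) by (auto simp: T_def)
      have "(\<Sum>i<n. c i *s hs i) = (\<Sum>i<n. c i *s w i) + (\<Sum>i<n. c i *s y i)"
        by (simp add: wy(1) scale_right_distrib sum.distrib)
      also have "\<dots> = (\<Sum>i<n. c i *s y i)" using c by simp
      also have "\<dots> \<in> span (B \<inter> N)"
        by (intro span_sum span_scale wy(3)) auto
      finally have "(\<Sum>i<n. c i *s hs i) \<in> N" using N by simp
      with ind c(2) show False by blast
    qed
  qed
  with lower[of T] fT show ?thesis by (simp add: T_def order_antisym)
qed

text \<open>Enlarges \<open>B\<close> inside \<open>V\<close> without losing the compatibility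
  \<open>good\<close> with any \<open>N j\<close>. The levels of the down-closed set
  \<open>S\<close> are treated upwards, and only vectors of \<open>N k\<close> are added at level
  \<open>k\<close>.\<close>

lemma (in vector_space) adapted_basis_step:
  fixes N :: "'j::linorder \<Rightarrow> 'b set"
  assumes B: "independent B" "B \<subseteq> V" and V: "subspace V" and T: "finite T"
    and sub: "\<And>j. j \<in> T \<Longrightarrow> subspace (N j)"
    and mono: "\<And>i j. i \<in> T \<Longrightarrow> j \<in> T \<Longrightarrow> i \<le> j \<Longrightarrow> N i \<subseteq> N j"
    and good: "\<And>j. j \<in> T \<Longrightarrow> span B \<inter> N j \<subseteq> span (B \<inter> N j)"
    and S: "S \<subseteq> T" "\<And>i j. i \<in> T \<Longrightarrow> j \<in> S \<Longrightarrow> i \<le> j \<Longrightarrow> i \<in> S"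
  shows "\<exists>B'. B \<subseteq> B' \<and> B' \<subseteq> V \<and> independent B' \<and>
    (\<forall>j\<in>S. V \<inter> N j \<subseteq> span B') \<and> (\<forall>j\<in>T. span B' \<inter> N j \<subseteq> span (B' \<inter> N j))"
proof -
  have "finite S" by (rule finite_subset[OF S(1) T])
  then show ?thesis using S
  proof (induction S rule: finite_linorder_max_induct)
    case empty
    then show ?case using B good by blast
  next
    case (insert k S)
    have "\<exists>B'. B \<subseteq> B' \<and> B' \<subseteq> V \<and> independent B' \<and>
      (\<forall>j\<in>S. V \<inter> N j \<subseteq> span B') \<and> (\<forall>j\<in>T. span B' \<inter> N j \<subseteq> span (B' \<inter> N j))"
    proof (rule insert.IH)
      show "S \<subseteq> T" using insert.prems by simp
      show "i \<in> S" if "i \<in> T" "j \<in> S" "i \<le> j" for i j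
        using that insert.prems(2)[of i j] insert.hyps(2) by fastforce
    qed
    then obtain C where C: "B \<subseteq> C" "C \<subseteq> V" "independent C"
      "\<And>j. j \<in> S \<Longrightarrow> V \<inter> N j \<subseteq> span C" "\<And>j. j \<in> T \<Longrightarrow> span C \<inter> N j \<subseteq> span (C \<inter> N j)"
      by blast
    obtain D where D: "C \<subseteq> D" "D \<subseteq> C \<union> (V \<inter> N k)" "independent D" "C \<union> (V \<inter> N k) \<subseteq> span D"
      by (rule maximal_independent_subset_extend[OF Un_upper1[of C "V \<inter> N k"] C(3)])
    have kT: "k \<in> T" using insert.prems by simp
    have "span D \<inter> N j \<subseteq> span (D \<inter> N j)" if j: "j \<in> T" for j
    proof
      fix x assume x: "x \<in> span D \<inter> N j"
      \<comment> \<open>Below \<open>k\<close> nothing new can appear, as \<open>C\<close> already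
        spans \<open>V \<inter> N j\<close>. From \<open>k\<close> on the added vectors lie in
        \<open>N j\<close>, so subtracting their contribution from \<open>x\<close> stays in
        \<open>N j\<close>.\<close>
      show "x \<in> span (D \<inter> N j)"
      proof (cases "j < k")
        case True
        then have "j \<in> S" using insert.prems(2)[of j k] j by fastforce
        have "span D \<subseteq> V" using D(2) C(2) by (intro span_minimal[OF _ V]) auto
        then have "x \<in> span C \<inter> N j" using x C(4)[OF \<open>j \<in> S\<close>] by auto
        then have "x \<in> span (C \<inter> N j)" using C(5)[OF j] by blast
        then show ?thesis using span_mono[of "C \<inter> N j" "D \<inter> N j"] D(1) by auto
      next
        case False
        then have kj: "N k \<subseteq> N j" using mono[OF kT j] by simp
        have "x \<in> span (C \<union> (D - C))" using x D(1) by (simp add: Un_absorb1)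
        then obtain y q where yq: "x = y + q" "y \<in> span C" "q \<in> span (D - C)"
          unfolding span_Un by blast
        have DC: "D - C \<subseteq> D \<inter> N j" using D(2) kj by auto
        then have q: "q \<in> span (D \<inter> N j)" using yq(3) span_mono by blast
        have "q \<in> N j" using yq(3) DC span_minimal[OF _ sub[OF j], of "D - C"] by auto
        moreover have "y = x - q" using yq(1) by simp
        ultimately have "y \<in> N j" using x subspace_diff[OF sub[OF j]] by simp
        then have "y \<in> span (C \<inter> N j)" using C(5)[OF j] yq(2) by blast
        then have "y \<in> span (D \<inter> N j)" using span_mono[of "C \<inter> N j" "D \<inter> N j"] D(1) by auto
        then show ?thesis using yq(1) q span_add by blast
      qed
    qed
    moreover have "V \<inter> N j \<subseteq> span D" if "j \<in> insert k S" for j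
      using that C(4) D(1,4) span_mono[OF D(1)] by blast
    ultimately show ?case using C D V by (intro exI[of _ D]) auto
  qed
qed

text \<open>Each level of \<open>Z\<close> is added, upwards, by one use of
  \<open>adapted_basis_step\<close>. The index \<open>m\<close> with \<open>N m = UNIV\<close>
  forces that step to span all of \<open>Z k\<close>; keeping \<open>B\<close> inside the union of
  the treated levels places it inside the next one.\<close>

lemma (in vector_space) adapted_basis_aux:
  fixes Z :: "'i::linorder \<Rightarrow> 'b set" and N :: "'j::linorder \<Rightarrow> 'b set"
  assumes S: "finite S" "\<And>i. i \<in> S \<Longrightarrow> subspace (Z i)"
      "\<And>i i'. i \<in> S \<Longrightarrow> i' \<in> S \<Longrightarrow> i \<le> i' \<Longrightarrow> Z i \<subseteq> Z i'"
    and T: "finite T" "\<And>j. j \<in> T \<Longrightarrow> subspace (N j)"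
      "\<And>j j'. j \<in> T \<Longrightarrow> j' \<in> T \<Longrightarrow> j \<le> j' \<Longrightarrow> N j \<subseteq> N j'"
      "m \<in> T" "N m = UNIV"
  shows "\<exists>B. independent B \<and> (\<forall>i\<in>S. span (B \<inter> Z i) = Z i) \<and> B \<subseteq> (\<Union>i\<in>S. Z i) \<and>
    (\<forall>j\<in>T. span B \<inter> N j \<subseteq> span (B \<inter> N j))"
  using S
proof (induction S rule: finite_linorder_max_induct)
  case empty
  have "(0::'b) \<in> span X" for X by (rule span_zero)
  then show ?case by (intro exI[of _ "{}"]) (auto simp: independent_empty)
next
  case (insert k S)
  have "\<exists>B. independent B \<and> (\<forall>i\<in>S. span (B \<inter> Z i) = Z i) \<and> B \<subseteq> (\<Union>i\<in>S. Z i) \<and>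
    (\<forall>j\<in>T. span B \<inter> N j \<subseteq> span (B \<inter> N j))"
    by (rule insert.IH) (use insert.prems in auto)
  then obtain B where B: "independent B" "\<And>i. i \<in> S \<Longrightarrow> span (B \<inter> Z i) = Z i"
    "B \<subseteq> (\<Union>i\<in>S. Z i)" "\<And>j. j \<in> T \<Longrightarrow> span B \<inter> N j \<subseteq> span (B \<inter> N j)"
    by blast
  have k: "subspace (Z k)" using insert.prems(1) by simp
  have up: "Z i \<subseteq> Z k" if "i \<in> S" for i
    using insert.prems(2)[of i k] insert.hyps(2) that by (auto simp: less_imp_le)
  have BZ: "B \<subseteq> Z k" using B(3) up by blast
  have "\<exists>B'. B \<subseteq> B' \<and> B' \<subseteq> Z k \<and> independent B' \<and>
    (\<forall>j\<in>T. Z k \<inter> N j \<subseteq> span B') \<and> (\<forall>j\<in>T. span B' \<inter> N j \<subseteq> span (B' \<inter> N j))"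
    by (rule adapted_basis_step[OF B(1) BZ k T(1,2,3) B(4)]) auto
  then obtain C where C: "B \<subseteq> C" "C \<subseteq> Z k" "independent C"
      "\<And>j. j \<in> T \<Longrightarrow> Z k \<inter> N j \<subseteq> span C" "\<And>j. j \<in> T \<Longrightarrow> span C \<inter> N j \<subseteq> span (C \<inter> N j)"
    by blast
  have "span (C \<inter> Z i) = Z i" if "i \<in> insert k S" for i
  proof
    show "span (C \<inter> Z i) \<subseteq> Z i"
      by (rule span_minimal) (use insert.prems(1) that in auto)
    show "Z i \<subseteq> span (C \<inter> Z i)"
    proof (cases "i = k")
      case True
      then show ?thesis using C(2) C(4)[OF T(4)] T(5) by (simp add: Int_absorb2)
    next
      case False
      then have "Z i = span (B \<inter> Z i)" using B(2) that by simp
      then show ?thesis using span_mono[of "B \<inter> Z i" "C \<inter> Z i"] C(1) by auto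
    qed
  qed
  then show ?case using C by (intro exI[of _ C]) auto
qed

text \<open>An element of this basis is a bar, born on entering Z and dying on entering N.\<close>

lemma (in vector_space) adapted_basis:
  fixes Z N :: "'i::linorder \<Rightarrow> 'b set"
  assumes T: "finite T" "\<And>i. i \<in> T \<Longrightarrow> subspace (Z i)" "\<And>i. i \<in> T \<Longrightarrow> subspace (N i)"
      "\<And>i j. i \<in> T \<Longrightarrow> j \<in> T \<Longrightarrow> i \<le> j \<Longrightarrow> Z i \<subseteq> Z j"
      "\<And>i j. i \<in> T \<Longrightarrow> j \<in> T \<Longrightarrow> i \<le> j \<Longrightarrow> N i \<subseteq> N j"
  obtains B where "independent B" "span B = UNIV"
    "\<And>i. i \<in> T \<Longrightarrow> span (B \<inter> Z i) = Z i" "\<And>i. i \<in> T \<Longrightarrow> span (B \<inter> N i) = N i"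
proof -
  \<comment> \<open>Reindexing by \<open>{..card T}\<close> leaves room for an extra level
    \<open>UNIV\<close> on top of both families. For \<open>N\<close> it plays the role of
    \<open>m\<close> in \<open>adapted_basis_aux\<close>, for \<open>Z\<close> it makes the basis
    span the whole space.\<close>
  define F where "F X n = (if n < card T then X (sorted_list_of_set T ! n) else UNIV)"
    for X :: "'i \<Rightarrow> 'b set" and n :: nat
  have nth: "sorted_list_of_set T ! n \<in> T" if "n < card T" for n
    using that T(1) nth_mem[of n "sorted_list_of_set T"] by simp
  have idx: "\<exists>n\<le>card T. n < card T \<and> sorted_list_of_set T ! n = i" if "i \<in> T" for i
    using that T(1) by (metis in_set_conv_nth length_sorted_list_of_set set_sorted_list_of_set less_imp_le)
  have le: "sorted_list_of_set T ! n \<le> sorted_list_of_set T ! m" if "n \<le> m" "m < card T" for n m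
    using that by (simp add: sorted_nth_mono)
  have Fmono: "F X n \<subseteq> F X m"
    if "\<And>i j. i \<in> T \<Longrightarrow> j \<in> T \<Longrightarrow> i \<le> j \<Longrightarrow> X i \<subseteq> X j" "n \<le> m" for X n m
    using that(2) that(1)[OF nth nth le] by (auto simp: F_def)
  have Fsub: "subspace (F X n)" if "\<And>i. i \<in> T \<Longrightarrow> subspace (X i)" for X n
    using that nth by (auto simp: F_def subspace_UNIV)
  have "\<exists>B. independent B \<and> (\<forall>n\<in>{..card T}. span (B \<inter> F Z n) = F Z n) \<and>
     B \<subseteq> (\<Union>n\<in>{..card T}. F Z n) \<and>
     (\<forall>n\<in>{..card T}. span B \<inter> F N n \<subseteq> span (B \<inter> F N n))"
    by (rule adapted_basis_aux[where m = "card T"])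
      (use Fsub[of Z] Fsub[of N] Fmono[of Z] Fmono[of N] T in \<open>auto simp: F_def\<close>)
  then obtain B where B: "independent B" "\<And>n. n \<le> card T \<Longrightarrow> span (B \<inter> F Z n) = F Z n"
     "\<And>n. n \<le> card T \<Longrightarrow> span B \<inter> F N n \<subseteq> span (B \<inter> F N n)"
    by auto
  have U: "span B = UNIV" using B(2)[of "card T"] by (simp add: F_def)
  show ?thesis
  proof (rule that[OF B(1) U])
    fix i assume i: "i \<in> T"
    then obtain n where n: "n \<le> card T" "n < card T" "sorted_list_of_set T ! n = i"
      using idx by blast
    show "span (B \<inter> Z i) = Z i" using B(2)[OF n(1)] n by (simp add: F_def)
    have "span (B \<inter> N i) \<subseteq> N i" by (rule span_minimal) (use T(3) i in auto)
    then show "span (B \<inter> N i) = N i" using B(3)[OF n(1)] n U by (auto simp: F_def)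
  qed
qed

text \<open>The transition matrices between two bases are mutually inverse. If b and c are basis
  vectors with x b + y b \<le> x c + y c, then every b' contributing to the (c, b) entry of their
  product is e-close to b or to c; this makes a product of matrices through the e-neighbours
  triangular with respect to x + y.\<close>

lemma (in vector_space) adapted_bases_neighbours:
  fixes x y x' y' :: "'b \<Rightarrow> real"
  assumes B: "independent B" "span B = UNIV" and C: "independent C" "span C = UNIV"
    and BC: "\<And>b c. b \<in> B \<Longrightarrow> c \<in> C \<Longrightarrow> representation C b c \<noteq> 0 \<Longrightarrow> x' c \<le> x b + e \<and> y' c \<le> y b + e"
    and CB: "\<And>b c. b \<in> B \<Longrightarrow> c \<in> C \<Longrightarrow> representation B c b \<noteq> 0 \<Longrightarrow> x b \<le> x' c + e \<and> y b \<le> y' c + e"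
    and S: "finite S" "S \<subseteq> B"
  obtains T where "finite T" "T \<subseteq> C" "card S \<le> card T"
    "\<And>c. c \<in> T \<Longrightarrow> \<exists>b\<in>S. \<bar>x b - x' c\<bar> \<le> e \<and> \<bar>y b - y' c\<bar> \<le> e"
proof -
  define near where "near b c \<longleftrightarrow> \<bar>x b - x' c\<bar> \<le> e \<and> \<bar>y b - y' c\<bar> \<le> e" for b c
  define R where "R b = {c. representation C b c \<noteq> 0}" for b
  have R: "finite (R b)" "R b \<subseteq> C" for b
    unfolding R_def by (auto intro: finite_representation representation_ne_zero)
  define T where "T = {c \<in> \<Union>(R ` S). \<exists>b\<in>S. near b c}"
  have T: "finite T" "T \<subseteq> C" using R S by (auto simp: T_def)
  have "card S \<le> card T"
  proof (rule ccontr)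
    assume "\<not> card S \<le> card T"
    then have less: "card T < card S" by simp
    \<comment> \<open>\<open>w b\<close> is the part of \<open>b\<close> carried by
      \<open>T\<close>. If \<open>T\<close> were too small, a nontrivial combination of these parts
      would vanish, leaving only contributions of vectors near no member of
      \<open>S\<close>.\<close>
    define w where "w b = (\<Sum>c\<in>R b \<inter> T. representation C b c *s c)" for b
    have wT: "w b \<in> span T" for b
      unfolding w_def by (intro span_sum span_scale span_base) auto
    obtain k where k: "(\<Sum>b\<in>S. k b *s w b) = 0" "\<exists>b\<in>S. k b \<noteq> 0"
      by (rule dependent_family[OF S(1) T(1) less wT])
    define S0 where "S0 = {b\<in>S. k b \<noteq> 0}"
    have S0: "finite S0" "S0 \<noteq> {}" using S k by (auto simp: S0_def)
    have "Max ((\<lambda>b. x b + y b) ` S0) \<in> (\<lambda>b. x b + y b) ` S0"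
      using S0 by (intro Max_in) auto
    then obtain a where a: "a \<in> S0" "Max ((\<lambda>b. x b + y b) ` S0) = x a + y a"
      by blast
    have amax: "x b + y b \<le> x a + y a" if "b \<in> S0" for b
      using Max_ge[of "(\<lambda>b. x b + y b) ` S0" "x b + y b"] S0 a(2) that by auto
    have aB: "a \<in> B" "a \<in> S" "k a \<noteq> 0" using a S by (auto simp: S0_def)
    have spB: "v \<in> span B" and spC: "v \<in> span C" for v using B C by auto
    have split: "b = w b + (\<Sum>c\<in>R b - T. representation C b c *s c)" for b
    proof -
      have "b = (\<Sum>c\<in>R b. representation C b c *s c)"
        unfolding R_def using sum_nonzero_representation_eq[OF C(1) spC] by simp
      then show ?thesis
        unfolding w_def using sum.Int_Diff[OF R(1), of "\<lambda>c. representation C b c *s c" b T] by simp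
    qed
    have "(\<Sum>b\<in>S. k b *s b) =
      (\<Sum>b\<in>S. k b *s w b) + (\<Sum>b\<in>S. k b *s (\<Sum>c\<in>R b - T. representation C b c *s c))"
      by (subst sum.distrib[symmetric], rule sum.cong[OF refl])
        (metis split scale_right_distrib)
    then have v: "(\<Sum>b\<in>S. k b *s b) = (\<Sum>b\<in>S. k b *s (\<Sum>c\<in>R b - T. representation C b c *s c))"
      using k by simp
    have rB: "representation B (\<Sum>i\<in>I. f i) b = (\<Sum>i\<in>I. representation B (f i) b)"
      for I :: "'b set" and f b
      using representation_sum[OF B(1), of I f] spB by simp
    have sB: "representation B (r *s v) b = r * representation B v b" for r v b
      using representation_scale[OF B(1) spB] by simp
    have "representation B (\<Sum>b\<in>S. k b *s b) a = (\<Sum>b\<in>S. if b = a then k a else 0)"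
      unfolding rB sB
      by (rule sum.cong) (use S in \<open>auto simp: representation_basis[OF B(1)] subset_iff\<close>)
    also have "\<dots> = k a" using S aB by simp
    finally have "k a = representation B (\<Sum>b\<in>S. k b *s b) a" ..
    also have "\<dots> = (\<Sum>b\<in>S. k b * (\<Sum>c\<in>R b - T. representation C b c * representation B c a))"
      unfolding v rB sB ..
    also have "\<dots> = 0"
    proof (rule sum.neutral, rule ballI)
      fix b assume b: "b \<in> S"
      show "k b * (\<Sum>c\<in>R b - T. representation C b c * representation B c a) = 0"
      proof (cases "k b = 0")
        case False
        then have ba: "x b + y b \<le> x a + y a" using amax[of b] b by (simp add: S0_def)
        have "representation C b c * representation B c a = 0" if c: "c \<in> R b - T" for c
        proof (rule ccontr)
          assume "representation C b c * representation B c a \<noteq> 0"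
          then have nz: "representation C b c \<noteq> 0" "representation B c a \<noteq> 0" by auto
          have cC: "c \<in> C" using c R by blast
          have 1: "x' c \<le> x b + e" "y' c \<le> y b + e" using BC[of b c] nz cC b S by auto
          have 2: "x a \<le> x' c + e" "y a \<le> y' c + e" using CB[of a c] nz cC aB by auto
          \<comment> \<open>An element outside \<open>T\<close> that occurs in \<open>b\<close> is
            near no member of \<open>S\<close>. Given \<open>1\<close>, not being near
            \<open>b\<close> forces \<open>x' c + y' c < x b + y b\<close>; given \<open>2\<close>,
            not being near \<open>a\<close> forces \<open>x a + y a < x' c + y' c\<close>. Together
            they contradict the choice of \<open>a\<close>.\<close>
          have "\<not> near b c" "\<not> near a c" using c b aB by (auto simp: T_def R_def)
          then show False unfolding near_def using 1 2 ba by linarith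
        qed
        then show ?thesis by (simp add: sum.neutral)
      qed simp
    qed
    finally show False using aB by simp
  qed
  moreover have "\<exists>b\<in>S. \<bar>x b - x' c\<bar> \<le> e \<and> \<bar>y b - y' c\<bar> \<le> e" if "c \<in> T" for c
    using that by (simp add: T_def near_def)
  ultimately show ?thesis by (rule that[OF T])
qed

section \<open>Multiplicities of a tame pair of filtrations\<close>

locale tame_filtration = vector_space scale
  for scale :: "'a::field \<Rightarrow> 'b::ab_group_add \<Rightarrow> 'b" (infixr "*s" 75) +
  fixes Z N :: "real \<Rightarrow> 'b set"
  assumes subspace_Z: "subspace (Z t)" and subspace_N: "subspace (N t)"
    and Z_mono: "s \<le> t \<Longrightarrow> Z s \<subseteq> Z t" and N_mono: "s \<le> t \<Longrightarrow> N s \<subseteq> N t"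
    and tame: "u < v \<Longrightarrow> quot_rank (Z u) (N v) \<noteq> \<infinity>"
begin

definition rk :: "real \<Rightarrow> real \<Rightarrow> nat" where
  "rk u v = the_enat (quot_rank (Z u) (N v))"

text \<open>Inclusion-exclusion for the number of bars born in (a, b] and dying in (c, d].
  \<open>mult_proper\<close> is the infimum of this count over boxes centred at the point.\<close>

definition box :: "real \<Rightarrow> real \<Rightarrow> real \<Rightarrow> real \<Rightarrow> int" where
  "box a b c d = int (rk b c) - int (rk a c) - int (rk b d) + int (rk a d)"

definition mult :: "real \<Rightarrow> real \<Rightarrow> nat" where
  "mult = mult_proper rk"

definition barcode :: "real set \<Rightarrow> 'b set \<Rightarrow> bool" where
  "barcode T B \<longleftrightarrow> independent B \<and> span B = UNIV \<and>
     (\<forall>t\<in>T. span (B \<inter> Z t) = Z t \<and> span (B \<inter> N t) = N t)"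

definition bars :: "'b set \<Rightarrow> real \<Rightarrow> real \<Rightarrow> real \<Rightarrow> real \<Rightarrow> 'b set" where
  "bars B a b c d = {x \<in> B. x \<in> Z b - Z a \<and> x \<in> N d - N c}"

lemma barcode_exists:
  assumes "finite T"
  obtains B where "barcode T B"
proof (rule adapted_basis[of T Z N])
  fix B assume "independent B" "span B = UNIV" "\<And>t. t \<in> T \<Longrightarrow> span (B \<inter> Z t) = Z t"
    "\<And>t. t \<in> T \<Longrightarrow> span (B \<inter> N t) = N t"
  then show thesis by (intro that[of B]) (simp add: barcode_def)
qed (use assms subspace_Z subspace_N Z_mono N_mono in auto)

lemma barcode_rk:
  assumes "barcode T B" "u \<in> T" "v \<in> T" "u < v"
  shows "finite ((B \<inter> Z u) - N v)" "card ((B \<inter> Z u) - N v) = rk u v"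
  using quot_rank_adapted[of B "Z u" "N v"] assms tame[of u v] by (auto simp: barcode_def rk_def)

text \<open>The number of bars in a window depends on ranks only, hence not on the adapted
  basis.\<close>

lemma card_bars:
  assumes B: "barcode T B" "a \<in> T" "b \<in> T" "c \<in> T" "d \<in> T" and le: "a \<le> b" "b < c" "c \<le> d"
  shows "finite (bars B a b c d)" "int (card (bars B a b c d)) = box a b c d"
proof -
  let ?X = "\<lambda>u v. (B \<inter> Z u) - N v"
  have f: "finite (?X b c)" "finite (?X a c)" "finite (?X b d)" "finite (?X a d)"
    and k: "card (?X b c) = rk b c" "card (?X a c) = rk a c" "card (?X b d) = rk b d" "card (?X a d) = rk a d"
    using barcode_rk[OF B(1)] B(2-) le by auto
  have m: "Z a \<subseteq> Z b" "N c \<subseteq> N d" using Z_mono N_mono le by auto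
  have e: "bars B a b c d = ?X b c - (?X a c \<union> ?X b d)" "?X a c \<inter> ?X b d = ?X a d"
    "?X a c \<union> ?X b d \<subseteq> ?X b c"
    using m by (auto simp: bars_def)
  show "finite (bars B a b c d)" using e(1) f(1) by simp
  have le1: "card (?X a c \<union> ?X b d) \<le> card (?X b c)"
    using e(3) f(1) by (rule card_mono[rotated])
  have "card (bars B a b c d) = card (?X b c) - card (?X a c \<union> ?X b d)"
    unfolding e(1) by (rule card_Diff_subset) (use e(3) f in auto)
  moreover have "card (?X a c) + card (?X b d) = card (?X a c \<union> ?X b d) + card (?X a d)"
    using card_Un_Int[OF f(2,3)] e(2) by simp
  ultimately show "int (card (bars B a b c d)) = box a b c d"
    using k le1 unfolding box_def by linarith
qed

lemma box_nonneg: "a \<le> b \<Longrightarrow> b < c \<Longrightarrow> c \<le> d \<Longrightarrow> 0 \<le> box a b c d"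
  by (rule barcode_exists[of "{a, b, c, d}"]) (use card_bars(2)[of "{a, b, c, d}" _ a b c d] in force)+

text \<open>One basis adapted to all eight times turns an inequality between alternating sums of
  ranks into an inclusion between sets of bars.\<close>

lemma box_mono:
  assumes "a' \<le> a" "a \<le> b" "b \<le> b'" "b' < c'" "c' \<le> c" "c \<le> d" "d \<le> d'"
  shows "box a b c d \<le> box a' b' c' d'"
proof -
  let ?T = "{a, b, c, d, a', b', c', d'}"
  obtain B where B: "barcode ?T B" by (rule barcode_exists[of ?T]) auto
  have "bars B a b c d \<subseteq> bars B a' b' c' d'"
    using assms Z_mono[of a' a] Z_mono[of b b'] N_mono[of c' c] N_mono[of d d']
    by (auto simp: bars_def)
  then have "card (bars B a b c d) \<le> card (bars B a' b' c' d')"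
    using card_bars(1)[OF B, of a' b' c' d'] assms by (intro card_mono) auto
  then show ?thesis
    using card_bars(2)[OF B, of a' b' c' d'] card_bars(2)[OF B, of a b c d] assms by simp
qed

lemma box_split_left: "box a b c d = box a m c d + box m b c d"
  and box_split_right: "box a b c d = box a b c m + box a b m d"
  by (simp_all add: box_def)

text \<open>Box counts are non-negative integers that can only drop as the box shrinks, so the
  infimum is attained and then persists for all smaller radii.\<close>

lemma mult_box:
  assumes "u < v"
  shows "\<exists>e0>0. \<forall>e. 0 < e \<and> e \<le> e0 \<longrightarrow> u + e < v - e \<and> box (u - e) (u + e) (v - e) (v + e) = int (mult u v)"
proof -
  define f where "f e = box (u - e) (u + e) (v - e) (v + e)" for e
  define S where "S = {f e | e. 0 < e \<and> u + e < v - e}"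
  have m: "mult u v = nat (Inf S)"
    unfolding mult_def mult_proper_def S_def f_def box_def ..
  have nonneg: "0 \<le> f e" if "0 < e" "u + e < v - e" for e
    unfolding f_def by (rule box_nonneg) (use that in auto)
  have "(v - u) / 4 > 0" "u + (v - u) / 4 < v - (v - u) / 4" using assms by (auto simp: field_simps)
  then have ne: "f ((v - u) / 4) \<in> S" unfolding S_def by blast
  define n where "n = (LEAST n. int n \<in> S)"
  have "\<exists>n. int n \<in> S"
    using ne nonneg by (auto simp: S_def) (metis nonneg int_nat_eq)
  then have n: "int n \<in> S" unfolding n_def by (rule LeastI_ex)
  have min: "int n \<le> s" if "s \<in> S" for s
  proof -
    have "0 \<le> s" using that nonneg by (auto simp: S_def)
    then have "n \<le> nat s" unfolding n_def using that by (intro Least_le) simp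
    then show ?thesis using \<open>0 \<le> s\<close> by linarith
  qed
  have "Inf S = int n" by (rule cInf_eq_minimum[OF n min])
  then have mn: "mult u v = n" using m by simp
  obtain e0 where e0: "0 < e0" "u + e0 < v - e0" "f e0 = int n" using n by (auto simp: S_def)
  have "u + e < v - e \<and> f e = int n" if e: "0 < e" "e \<le> e0" for e
  proof
    show lt: "u + e < v - e" using e e0 by linarith
    have "f e \<le> f e0" unfolding f_def by (rule box_mono) (use e e0 in auto)
    moreover have "int n \<le> f e" by (rule min) (use e lt in \<open>auto simp: S_def\<close>)
    ultimately show "f e = int n" using e0 by simp
  qed
  then show ?thesis using e0 mn unfolding f_def by blast
qed

lemma mult_le_box:
  assumes "u < v" "a < u" "u < b" "b < c" "c < v" "v < d"
  shows "int (mult u v) \<le> box a b c d"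
proof -
  obtain e0 where e0: "e0 > 0" "\<And>e. 0 < e \<and> e \<le> e0 \<Longrightarrow> u + e < v - e \<and>
      box (u - e) (u + e) (v - e) (v + e) = int (mult u v)"
    using mult_box[OF assms(1)] by blast
  define e where "e = Min {e0, u - a, b - u, v - c, d - v}"
  have e: "0 < e" "e \<le> e0" "e \<le> u - a" "e \<le> b - u" "e \<le> v - c" "e \<le> d - v"
    using assms e0(1) by (auto simp: e_def)
  have "box (u - e) (u + e) (v - e) (v + e) \<le> box a b c d"
    by (rule box_mono) (use e assms in auto)
  then show ?thesis using e0(2)[of e] e by simp
qed

text \<open>A small box around \<open>(u, v)\<close> counts exactly \<open>mult u v\<close> bars,
  which leaves no room for a second point.\<close>

lemma mult_isolated:
  assumes uv: "u < v"
  shows "\<exists>e>0. \<forall>x y. \<bar>x - u\<bar> < e \<and> \<bar>y - v\<bar> < e \<and> mult x y > 0 \<longrightarrow> x = u \<and> y = v"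
proof -
  obtain e where e: "e > 0" "\<And>e'. 0 < e' \<and> e' \<le> e \<Longrightarrow> u + e' < v - e' \<and>
      box (u - e') (u + e') (v - e') (v + e') = int (mult u v)"
    using mult_box[OF uv] by blast
  have lt: "u + e < v - e" and be: "box (u - e) (u + e) (v - e) (v + e) = int (mult u v)"
    using e(2)[of e] e(1) by auto
  have "x = u \<and> y = v" if xy: "\<bar>x - u\<bar> < e" "\<bar>y - v\<bar> < e" "mult x y > 0" for x y
  proof (rule ccontr)
    assume ne: "\<not> (x = u \<and> y = v)"
    have xyl: "x < y" using xy lt by linarith
    \<comment> \<open>A line separating the two points cuts the box into two parts,
      each with at least the multiplicity of the point it contains.\<close>
    consider "x < u" | "u < x" | "y < v" | "v < y" using ne by linarith
    then have "int (mult u v) + int (mult x y) \<le> box (u - e) (u + e) (v - e) (v + e)"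
    proof cases
      case 1
      define m where "m = (x + u) / 2"
      have "x < m" "m < u" using 1 by (auto simp: m_def)
      then show ?thesis
        using mult_le_box[of u v m "u + e" "v - e" "v + e"] mult_le_box[of x y "u - e" m "v - e" "v + e"]
          uv e(1) lt xy xyl by (subst box_split_left[of _ _ _ _ m]) force
    next
      case 2
      define m where "m = (x + u) / 2"
      have "u < m" "m < x" using 2 by (auto simp: m_def)
      then show ?thesis
        using mult_le_box[of u v "u - e" m "v - e" "v + e"] mult_le_box[of x y m "u + e" "v - e" "v + e"]
          uv e(1) lt xy xyl by (subst box_split_left[of _ _ _ _ m]) force
    next
      case 3
      define m where "m = (y + v) / 2"
      have "y < m" "m < v" using 3 by (auto simp: m_def)
      then show ?thesis
        using mult_le_box[of u v "u - e" "u + e" m "v + e"] mult_le_box[of x y "u - e" "u + e" "v - e" m]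
          uv e(1) lt xy xyl by (subst box_split_right[of _ _ _ _ m]) force
    next
      case 4
      define m where "m = (y + v) / 2"
      have "v < m" "m < y" using 4 by (auto simp: m_def)
      then show ?thesis
        using mult_le_box[of u v "u - e" "u + e" "v - e" m] mult_le_box[of x y "u - e" "u + e" m "v + e"]
          uv e(1) lt xy xyl by (subst box_split_right[of _ _ _ _ m]) force
    qed
    then show False using be xy(3) by simp
  qed
  then show ?thesis using e(1) by blast
qed

lemma finite_mult_support:
  assumes K: "compact K" "\<And>x y. (x, y) \<in> K \<Longrightarrow> x < y"
  shows "finite {(x, y). (x, y) \<in> K \<and> mult x y > 0}" (is "finite ?S")
proof (rule ccontr)
  assume "infinite ?S"
  then obtain p where p: "p \<in> K" "p islimpt ?S"
    using K(1)[unfolded compact_eq_Bolzano_Weierstrass] by (metis (no_types, lifting) Collect_case_prodD mem_Collect_eq prod.collapse subsetI)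
  obtain u v where uv: "p = (u, v)" by force
  obtain e where e: "e > 0" "\<And>x y. \<bar>x - u\<bar> < e \<and> \<bar>y - v\<bar> < e \<and> mult x y > 0 \<Longrightarrow> x = u \<and> y = v"
    using mult_isolated[of u v] K(2) p uv by blast
  obtain q where q: "q \<in> ?S" "q \<noteq> p" "dist q p < e"
    using p(2) e(1) unfolding islimpt_approachable by blast
  have "\<bar>fst q - u\<bar> < e" "\<bar>snd q - v\<bar> < e"
    using q(3) dist_fst_le[of q p] dist_snd_le[of q p] uv by (auto simp: dist_real_def)
  then show False using e(2)[of "fst q" "snd q"] q uv by auto
qed

text \<open>The passage from bars to points: a window with a positive count contains a point of the
  diagram. Around a point of multiplicity 0 small boxes count nothing, and additivity of
  \<open>box\<close> glues small boxes by bisection in each coordinate.\<close>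

lemma box_eq_0:
  assumes le: "a \<le> b" "b < c" "c \<le> d"
    and zero: "\<And>x y. a \<le> x \<Longrightarrow> x \<le> b \<Longrightarrow> c \<le> y \<Longrightarrow> y \<le> d \<Longrightarrow> mult x y = 0"
  shows "box a b c d = 0"
proof -
  \<comment> \<open>First bisection, in the second coordinate: over a fixed \<open>x\<close> a thin
    enough column of full height is empty. Such columns are the local input for the bisection in the
    first coordinate.\<close>
  have col: "\<exists>\<delta>>0. \<forall>a' b'. a' \<le> x \<and> x \<le> b' \<and> b' - a' < \<delta> \<longrightarrow> box a' b' c d = 0"
    if x: "a \<le> x" "x \<le> b" for x
    using le(3)
  proof (induction rule: Bolzano[consumes 1])
    case (trans p q r)
    then obtain \<delta>1 \<delta>2 where "\<delta>1 > 0" "\<delta>2 > 0"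
      "\<And>a' b'. a' \<le> x \<and> x \<le> b' \<and> b' - a' < \<delta>1 \<Longrightarrow> box a' b' p q = 0"
      "\<And>a' b'. a' \<le> x \<and> x \<le> b' \<and> b' - a' < \<delta>2 \<Longrightarrow> box a' b' q r = 0" by blast
    then show ?case
      by (intro exI[of _ "min \<delta>1 \<delta>2"]) (auto simp: box_split_right[of _ _ p r q])
  next
    case (local y)
    have "mult x y = 0" using zero x local by simp
    moreover have "x < y" using x local le by linarith
    ultimately obtain e where e: "e > 0" "x + e < y - e" "box (x - e) (x + e) (y - e) (y + e) = 0"
      using mult_box[of x y] by force
    have "box a' b' c' d' = 0"
      if "c' \<le> y \<and> y \<le> d' \<and> d' - c' < e" "a' \<le> x \<and> x \<le> b' \<and> b' - a' < e" for a' b' c' d'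
    proof (rule antisym)
      show "box a' b' c' d' \<le> 0"
        unfolding e(3)[symmetric] by (rule box_mono) (use that e in auto)
      show "0 \<le> box a' b' c' d'" by (rule box_nonneg) (use that e in auto)
    qed
    then show ?case using e(1) by blast
  qed
  show ?thesis
    using le(1)
  proof (induction rule: Bolzano[consumes 1])
    case (trans p q r)
    then show ?case by (simp add: box_split_left[of p r _ _ q])
  next
    case (local x)
    then show ?case using col[of x] by blast
  qed
qed

end

section \<open>Hall's condition for interleaved filtrations\<close>

text \<open>With both families equal to the whole space from \<open>L\<close> on, every vector has
  an entry time and every bar is dead at \<open>L\<close>. Together with \<open>rk_neg\<close> this
  confines the diagram to a bounded square, so that only finitely many points are far from the
  diagonal.\<close>

locale capped_filtration = tame_filtration scale Z N
  for scale :: "'a::field \<Rightarrow> 'b::ab_group_add \<Rightarrow> 'b" (infixr "*s" 75) and Z N +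
  fixes L :: real
  assumes L_pos: "0 < L"
    and Z_top: "L \<le> t \<Longrightarrow> Z t = UNIV" and N_top: "L \<le> t \<Longrightarrow> N t = UNIV"
    and rk_neg: "u < 0 \<Longrightarrow> u < v \<Longrightarrow> rk u v = 0"
begin

lemma rk_top:
  assumes "u < v" "L \<le> v"
  shows "rk u v = 0"
proof -
  obtain B where B: "barcode {u, v} B" by (rule barcode_exists[of "{u, v}"]) auto
  show ?thesis using barcode_rk(2)[OF B, of u v] assms N_top[of v] by simp
qed

lemma mult_support:
  assumes "u < v" "mult u v > 0"
  shows "0 \<le> u" "v \<le> L"
proof -
  have rkz: "box a b c d = 0" if "b < 0" "a \<le> b" "b < c" "c \<le> d" for a b c d
    using rk_neg[of a c] rk_neg[of b c] rk_neg[of a d] rk_neg[of b d] that by (simp add: box_def)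
  have rkt: "box a b c d = 0" if "L \<le> c" "a \<le> b" "b < c" "c \<le> d" for a b c d
    using rk_top[of a c] rk_top[of b c] rk_top[of a d] rk_top[of b d] that by (simp add: box_def)
  define h where "h = (v - u) / 3"
  have h: "h > 0" "u + h < v - h" using assms(1) by (auto simp: h_def field_simps)
  show "0 \<le> u"
  proof (rule ccontr)
    assume "\<not> 0 \<le> u"
    then have b: "u < min (u / 2) (u + h)" "min (u / 2) (u + h) < 0" using h by auto
    have "int (mult u v) \<le> box (u - 1) (min (u / 2) (u + h)) (v - h) (v + 1)"
      by (rule mult_le_box) (use assms h b in auto)
    also have "\<dots> = 0" by (rule rkz) (use assms h b in auto)
    finally show False using assms(2) by simp
  qed
  show "v \<le> L"
  proof (rule ccontr)
    assume "\<not> v \<le> L"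
    then have c: "max ((v + L) / 2) (v - h) < v" "L \<le> max ((v + L) / 2) (v - h)"
      using h by (auto simp: max_def)
    have "int (mult u v) \<le> box (u - 1) (u + h) (max ((v + L) / 2) (v - h)) (v + 1)"
      by (rule mult_le_box) (use assms h c in auto)
    also have "\<dots> = 0" by (rule rkt) (use assms h c in auto)
    finally show False using assms(2) by simp
  qed
qed

lemma finite_mult_far:
  assumes "\<kappa> > 0"
  shows "finite {(x, y). \<kappa> \<le> y - x \<and> mult x y > 0}"
proof -
  define K where "K = {p :: real \<times> real. \<kappa> \<le> snd p - fst p} \<inter> cbox (0, 0) (L, L)"
  have "compact K"
    unfolding K_def
    by (intro closed_Int_compact compact_cbox closed_Collect_le continuous_intros)
  then have "finite {(x, y). (x, y) \<in> K \<and> mult x y > 0}"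
    by (rule finite_mult_support) (use assms in \<open>auto simp: K_def\<close>)
  moreover have "{(x, y). \<kappa> \<le> y - x \<and> mult x y > 0} \<subseteq> {(x, y). (x, y) \<in> K \<and> mult x y > 0}"
  proof clarify
    fix x y assume *: "\<kappa> \<le> y - x" "0 < mult x y"
    then have "0 \<le> x" "y \<le> L" "x < y" using mult_support[of x y] assms by auto
    then show "(x, y) \<in> K" using * by (simp add: K_def cbox_Pair_eq)
  qed
  ultimately show ?thesis by (rule finite_subset[rotated])
qed

end

section \<open>Entry times on a finite mesh and their shift under interleaving\<close>

definition entry :: "(real \<Rightarrow> 'b set) \<Rightarrow> real set \<Rightarrow> 'b \<Rightarrow> real" where
  "entry F T x = Min {t \<in> T. x \<in> F t}"

lemma entry:
  assumes "finite T" "L \<in> T" "F L = UNIV"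
  shows "entry F T x \<in> T" "x \<in> F (entry F T x)" "entry F T x \<le> L"
proof -
  have "finite {t \<in> T. x \<in> F t}" "L \<in> {t \<in> T. x \<in> F t}" using assms by auto
  then have "entry F T x \<in> {t \<in> T. x \<in> F t}" "entry F T x \<le> L"
    unfolding entry_def by (intro Min_in Min_le; blast)+
  then show "entry F T x \<in> T" "x \<in> F (entry F T x)" "entry F T x \<le> L" by auto
qed

lemma entry_le_iff:
  assumes "finite T" "L \<in> T" "F L = UNIV" "\<And>s t. s \<le> t \<Longrightarrow> F s \<subseteq> F t" "t \<in> T"
  shows "entry F T x \<le> t \<longleftrightarrow> x \<in> F t"
proof
  assume "entry F T x \<le> t"
  then show "x \<in> F t" using entry(2)[OF assms(1,2), of F x] assms(3,4) by blast
next
  assume "x \<in> F t"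
  then show "entry F T x \<le> t" unfolding entry_def using assms by (intro Min_le) auto
qed

text \<open>In an adapted basis a vector of \<open>W\<close> has no coordinates outside
  \<open>W\<close>; this is how inclusions between filtrations constrain the transition
  matrices.\<close>

lemma (in vector_space) representation_mem:
  assumes "independent B" "span (B \<inter> W) = W" "v \<in> W" "representation B v b \<noteq> 0"
  shows "b \<in> W"
proof -
  have "representation B v = representation (B \<inter> W) v"
    by (rule representation_extend) (use assms in auto)
  then show ?thesis using representation_ne_zero[of "B \<inter> W" v b] assms(4) by auto
qed

text \<open>By \<open>rk_neg\<close>, no class present at time -1 survives to a later time.
  Including -1 therefore gives every relevant bar a sampling time strictly before its birth.\<close>

definition mesh :: "real \<Rightarrow> real \<Rightarrow> real set \<Rightarrow> bool" where
  "mesh L \<delta> T \<longleftrightarrow> finite T \<and> L \<in> T \<and> - 1 \<in> T \<and> T \<subseteq> {- 1..} \<and>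
     (\<forall>s. - 1 \<le> s \<longrightarrow> s \<le> L \<longrightarrow> (\<exists>t\<in>T. s \<le> t \<and> t \<le> s + \<delta>))"

lemma mesh_extend:
  assumes "\<delta> > 0" "finite X" "X \<subseteq> {- 1..}" "0 < L"
  obtains T where "mesh L \<delta> T" "X \<subseteq> T"
proof -
  define n where "n = nat \<lceil>(L + 1) / \<delta>\<rceil>"
  define M where "M = (\<lambda>i. - 1 + real i * \<delta>) ` {..n}"
  have "\<exists>t\<in>M. s \<le> t \<and> t \<le> s + \<delta>" if s: "- 1 \<le> s" "s \<le> L" for s
  proof -
    define i where "i = nat \<lceil>(s + 1) / \<delta>\<rceil>"
    have "(s + 1) / \<delta> \<le> (L + 1) / \<delta>" using s assms by (simp add: divide_right_mono)
    then have "i \<le> n" unfolding i_def n_def by (intro nat_mono ceiling_mono)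
    moreover have "0 \<le> (s + 1) / \<delta>" using s assms by simp
    then have "real i = of_int \<lceil>(s + 1) / \<delta>\<rceil>" unfolding i_def by (simp add: order_trans)
    then have "(s + 1) / \<delta> \<le> real i" "real i < (s + 1) / \<delta> + 1"
      using ceiling_correct[of "(s + 1) / \<delta>"] by linarith+
    then have "s + 1 \<le> real i * \<delta>" "real i * \<delta> \<le> s + 1 + \<delta>"
      using assms by (auto simp: field_simps)
    ultimately show ?thesis unfolding M_def by (intro bexI[of _ "- 1 + real i * \<delta>"]) auto
  qed
  moreover have "- 1 \<in> M" unfolding M_def by (rule image_eqI[of _ _ 0]) auto
  moreover have "finite M" "M \<subseteq> {- 1..}" using assms by (auto simp: M_def)
  ultimately have "mesh L \<delta> (insert L (X \<union> M))" using assms unfolding mesh_def by auto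
  then show ?thesis using that by blast
qed

text \<open>With \<open>s\<close> the entry time of \<open>b\<close>, the vector \<open>b\<close>
  lies in \<open>F' (s + \<epsilon>)\<close>, hence in \<open>F' t\<close> for a sampling time
  \<open>t\<close> at most \<open>\<delta>\<close> later; so does every \<open>c\<close> occurring
  in \<open>b\<close>. If \<open>s + \<epsilon>\<close> exceeds \<open>L\<close>, the bound holds
  because entry times are at most \<open>L\<close>.\<close>

lemma (in vector_space) entry_shift:
  assumes T: "mesh L \<delta> S" "mesh L \<delta> T" and "0 \<le> \<epsilon>" "0 \<le> \<delta>"
    and C: "independent C" "\<And>t. t \<in> T \<Longrightarrow> span (C \<inter> F' t) = F' t"
    and mono: "\<And>s t. s \<le> t \<Longrightarrow> F s \<subseteq> F t" "\<And>s t. s \<le> t \<Longrightarrow> F' s \<subseteq> F' t"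
    and top: "F L = UNIV" "F' L = UNIV" and shift: "\<And>t. F t \<subseteq> F' (t + \<epsilon>)"
    and nz: "representation C b c \<noteq> 0"
  shows "entry F' T c \<le> entry F S b + (\<epsilon> + \<delta>)"
proof -
  have S: "finite S" "L \<in> S" "S \<subseteq> {- 1..}" and T': "finite T" "L \<in> T"
    "\<And>s. - 1 \<le> s \<Longrightarrow> s \<le> L \<Longrightarrow> \<exists>t\<in>T. s \<le> t \<and> t \<le> s + \<delta>"
    using T by (auto simp: mesh_def)
  define s where "s = entry F S b"
  have s: "s \<in> S" "b \<in> F s" using entry[of S L F b, OF S(1,2) top(1)] by (auto simp: s_def)
  have "- 1 \<le> s" using s(1) S(3) by auto
  show ?thesis
  proof (cases "s + \<epsilon> \<le> L")
    case True
    then obtain t where t: "t \<in> T" "s + \<epsilon> \<le> t" "t \<le> s + \<epsilon> + \<delta>"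
      using T'(3)[of "s + \<epsilon>"] \<open>- 1 \<le> s\<close> \<open>0 \<le> \<epsilon>\<close> by auto
    have "b \<in> F' t" using s(2) shift[of s] mono(2)[OF t(2)] by blast
    then have "c \<in> F' t" by (rule representation_mem[OF C(1) C(2)[OF t(1)] _ nz])
    then have "entry F' T c \<le> t" using entry_le_iff[of T L F' t c, OF T'(1,2) top(2) mono(2) t(1)] by blast
    then show ?thesis using t by (simp add: s_def)
  next
    case False
    then show ?thesis using entry(3)[of T L F' c, OF T'(1,2) top(2)] \<open>0 \<le> \<delta>\<close> by (simp add: s_def)
  qed
qed

lemma finite_common_radius:
  fixes P :: "'c \<Rightarrow> real \<Rightarrow> bool"
  assumes "finite Q" "\<And>q. q \<in> Q \<Longrightarrow> \<exists>e0>0. \<forall>e. 0 < e \<and> e \<le> e0 \<longrightarrow> P q e" "0 < d"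
  obtains e where "0 < e" "e \<le> d" "\<And>q. q \<in> Q \<Longrightarrow> P q e"
proof -
  have "\<exists>e0>0. \<forall>q\<in>Q. \<forall>e. 0 < e \<and> e \<le> e0 \<longrightarrow> P q e"
    using assms(1,2)
  proof (induction Q rule: finite_induct)
    case empty
    then show ?case by (intro exI[of _ 1]) auto
  next
    case (insert q Q)
    obtain e1 where "e1 > 0" "\<forall>q\<in>Q. \<forall>e. 0 < e \<and> e \<le> e1 \<longrightarrow> P q e" using insert by auto
    moreover obtain e2 where "e2 > 0" "\<forall>e. 0 < e \<and> e \<le> e2 \<longrightarrow> P q e" using insert.prems by auto
    ultimately show ?case by (intro exI[of _ "min e1 e2"]) auto
  qed
  then obtain e0 where "e0 > 0" "\<forall>q\<in>Q. \<forall>e. 0 < e \<and> e \<le> e0 \<longrightarrow> P q e" by blast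
  then show ?thesis using that[of "min d e0"] assms(3) by auto
qed

locale interleaved = A: capped_filtration scale Z N L + B: capped_filtration scale Z' N' L
  for scale :: "'a::field \<Rightarrow> 'b::ab_group_add \<Rightarrow> 'b" (infixr "*s" 75) and Z N Z' N' L +
  fixes \<epsilon> :: real
  assumes eps: "0 \<le> \<epsilon>"
    and Z_shift: "Z t \<subseteq> Z' (t + \<epsilon>)" "Z' t \<subseteq> Z (t + \<epsilon>)"
    and N_shift: "N t \<subseteq> N' (t + \<epsilon>)" "N' t \<subseteq> N (t + \<epsilon>)"
begin

lemma barcodes_neighbours:
  assumes "mesh L \<delta> S" "mesh L \<delta> T" "0 \<le> \<delta>" and B: "A.barcode S B" and C: "B.barcode T C"
    and X: "finite X" "X \<subseteq> B"
  obtains Y where "finite Y" "Y \<subseteq> C" "card X \<le> card Y"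
    "\<forall>c\<in>Y. \<exists>b\<in>X. \<bar>entry Z S b - entry Z' T c\<bar> \<le> \<epsilon> + \<delta> \<and>
       \<bar>entry N S b - entry N' T c\<bar> \<le> \<epsilon> + \<delta>"
proof (rule A.adapted_bases_neighbours[of B C "entry Z' T" "entry Z S" "\<epsilon> + \<delta>" "entry N' T" "entry N S" X])
  show "A.independent B" "A.span B = UNIV" "A.independent C" "A.span C = UNIV"
    using B C by (auto simp: A.barcode_def B.barcode_def)
  show "entry Z' T c \<le> entry Z S b + (\<epsilon> + \<delta>) \<and> entry N' T c \<le> entry N S b + (\<epsilon> + \<delta>)"
    if "A.representation C b c \<noteq> 0" for b c
    using A.entry_shift[OF assms(1,2) eps assms(3), of C Z' Z b c]
      A.entry_shift[OF assms(1,2) eps assms(3), of C N' N b c] that C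
      A.Z_mono A.N_mono B.Z_mono B.N_mono A.Z_top A.N_top B.Z_top B.N_top Z_shift N_shift
    by (simp add: B.barcode_def)
  show "entry Z S b \<le> entry Z' T c + (\<epsilon> + \<delta>) \<and> entry N S b \<le> entry N' T c + (\<epsilon> + \<delta>)"
    if "A.representation B c b \<noteq> 0" for b c
    using A.entry_shift[OF assms(2,1) eps assms(3), of B Z Z' c b]
      A.entry_shift[OF assms(2,1) eps assms(3), of B N N' c b] that B
      A.Z_mono A.N_mono B.Z_mono B.N_mono A.Z_top A.N_top B.Z_top B.N_top Z_shift N_shift
    by (simp add: A.barcode_def)
qed (use X that in auto)

text \<open>Choose finite time sets of small mesh that also contain the sides of tiny boxes isolating the
  diagram points. Then the points in P correspond to disjoint sets of bars, their neighbours on the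
  other side are bars far from the diagonal, and every such bar lies in the box of a nearby point.\<close>

lemma mult_hall:
  assumes eta: "\<epsilon> < \<eta>" and P: "finite P" "\<And>u v. (u, v) \<in> P \<Longrightarrow> 2 * \<eta> < v - u"
  defines "Q \<equiv> {(x, y). x < y \<and> B.mult x y > 0 \<and> (\<exists>(u, v)\<in>P. \<bar>x - u\<bar> \<le> \<eta> \<and> \<bar>y - v\<bar> \<le> \<eta>)}"
  shows "finite Q" "(\<Sum>(u, v)\<in>P. A.mult u v) \<le> (\<Sum>(x, y)\<in>Q. B.mult x y)"
proof -
  show finQ: "finite Q"
  proof -
    \<comment> \<open>Moving both coordinates by at most \<open>\<eta>\<close> costs at most
      \<open>2 * \<eta>\<close> of persistence, so the finitely many points of \<open>P\<close>
      leave a common margin \<open>\<kappa>\<close> for all of \<open>Q\<close>.\<close>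
    obtain \<kappa> where k: "\<kappa> > 0" "\<And>p. p \<in> P \<Longrightarrow> \<kappa> \<le> snd p - fst p - 2 * \<eta>"
    proof (rule finite_common_radius[of P "\<lambda>p e. e \<le> snd p - fst p - 2 * \<eta>" 1])
      show "\<exists>e0>0. \<forall>e. 0 < e \<and> e \<le> e0 \<longrightarrow> e \<le> snd p - fst p - 2 * \<eta>" if "p \<in> P" for p
        using P(2)[of "fst p" "snd p"] that by (intro exI[of _ "snd p - fst p - 2 * \<eta>"]) auto
    qed (use P in auto)
    have "Q \<subseteq> {(x, y). \<kappa> \<le> y - x \<and> B.mult x y > 0}"
      unfolding Q_def using k(2) by fastforce
    then show ?thesis by (rule finite_subset[OF _ B.finite_mult_far[OF k(1)]])
  qed
  \<comment> \<open>The slack pays for the box radius, the mesh and a window of width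
    \<open>2 * \<delta>\<close> around a bar: the errors add up to at most
    \<open>\<epsilon> + 4 * \<delta>\<close>. The bound 1 keeps the sides of the boxes from falling
    below -1.\<close>
  define \<delta> where "\<delta> = min 1 ((\<eta> - \<epsilon>) / 8)"
  have d: "0 < \<delta>" "\<delta> \<le> 1" "8 * \<delta> \<le> \<eta> - \<epsilon>" using eta by (auto simp: \<delta>_def min_def)
  define P0 where "P0 = {p \<in> P. A.mult (fst p) (snd p) > 0}"
  have P0: "finite P0" "P0 \<subseteq> P" using P by (auto simp: P0_def)
  have P0b: "2 * \<eta> < snd p - fst p" "0 \<le> fst p" if "p \<in> P0" for p
  proof -
    show g: "2 * \<eta> < snd p - fst p" using P(2)[of "fst p" "snd p"] that P0 by auto
    then have "fst p < snd p" using eta eps by linarith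
    then show "0 \<le> fst p" using A.mult_support(1)[of "fst p" "snd p"] that by (simp add: P0_def)
  qed
  \<comment> \<open>A radius at which boxes around distinct points of \<open>P0\<close> cannot share
    a bar.\<close>
  obtain e where e: "0 < e" "e \<le> \<delta>"
    "\<And>p. p \<in> P0 \<times> P0 \<Longrightarrow> fst p \<noteq> snd p \<longrightarrow>
       \<not> (\<bar>fst (fst p) - fst (snd p)\<bar> \<le> 2 * e \<and> \<bar>snd (fst p) - snd (snd p)\<bar> \<le> 2 * e)"
  proof (rule finite_common_radius[of "P0 \<times> P0" "\<lambda>p e. fst p \<noteq> snd p \<longrightarrow>
       \<not> (\<bar>fst (fst p) - fst (snd p)\<bar> \<le> 2 * e \<and> \<bar>snd (fst p) - snd (snd p)\<bar> \<le> 2 * e)" \<delta>])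
    fix p :: "(real \<times> real) \<times> (real \<times> real)"
    define m where "m = max \<bar>fst (fst p) - fst (snd p)\<bar> \<bar>snd (fst p) - snd (snd p)\<bar>"
    have "m > 0" if "fst p \<noteq> snd p" using that unfolding m_def by (auto simp: prod_eq_iff)
    then show "\<exists>e0>0. \<forall>e. 0 < e \<and> e \<le> e0 \<longrightarrow> fst p \<noteq> snd p \<longrightarrow>
       \<not> (\<bar>fst (fst p) - fst (snd p)\<bar> \<le> 2 * e \<and> \<bar>snd (fst p) - snd (snd p)\<bar> \<le> 2 * e)"
      by (intro exI[of _ "if fst p = snd p then 1 else m / 3"]) (auto simp: m_def)
  qed (use P0 d in auto)
  \<comment> \<open>Every point that will be needed on the other side has persistence at least
    \<open>2 * \<delta>\<close>. These are finitely many, so one radius \<open>f\<close> makes all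
    their boxes count exactly the multiplicity.\<close>
  define Q0 where "Q0 = {(x, y). 2 * \<delta> \<le> y - x \<and> B.mult x y > 0}"
  have finQ0: "finite Q0" unfolding Q0_def by (rule B.finite_mult_far) (use d in auto)
  obtain f where f: "0 < f" "f \<le> \<delta>"
    "\<And>q. q \<in> Q0 \<Longrightarrow> fst q + f < snd q - f \<and>
       B.box (fst q - f) (fst q + f) (snd q - f) (snd q + f) = int (B.mult (fst q) (snd q))"
  proof (rule finite_common_radius[of Q0 "\<lambda>q f. fst q + f < snd q - f \<and>
       B.box (fst q - f) (fst q + f) (snd q - f) (snd q + f) = int (B.mult (fst q) (snd q))" \<delta>])
    fix q assume "q \<in> Q0"
    then have "fst q < snd q" using d by (auto simp: Q0_def)
    then show "\<exists>e0>0. \<forall>e. 0 < e \<and> e \<le> e0 \<longrightarrow> fst q + e < snd q - e \<and>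
       B.box (fst q - e) (fst q + e) (snd q - e) (snd q + e) = int (B.mult (fst q) (snd q))"
      by (rule B.mult_box)
  qed (use finQ0 d in auto)
  have Q0b: "0 \<le> fst q" "2 * \<delta> \<le> snd q - fst q" if "q \<in> Q0" for q
    using that B.mult_support(1)[of "fst q" "snd q"] d by (auto simp: Q0_def)
  obtain S where S: "mesh L \<delta> S" "(\<Union>p\<in>P0. {fst p - e, fst p + e, snd p - e, snd p + e}) \<subseteq> S"
  proof (rule mesh_extend[of \<delta> "\<Union>p\<in>P0. {fst p - e, fst p + e, snd p - e, snd p + e}" L])
    show "(\<Union>p\<in>P0. {fst p - e, fst p + e, snd p - e, snd p + e}) \<subseteq> {- 1..}"
      using P0b e d eta eps by fastforce
  qed (use d P0 A.L_pos in auto)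
  obtain T where T: "mesh L \<delta> T" "(\<Union>q\<in>Q0. {fst q - f, fst q + f, snd q - f, snd q + f}) \<subseteq> T"
  proof (rule mesh_extend[of \<delta> "\<Union>q\<in>Q0. {fst q - f, fst q + f, snd q - f, snd q + f}" L])
    show "(\<Union>q\<in>Q0. {fst q - f, fst q + f, snd q - f, snd q + f}) \<subseteq> {- 1..}"
      using Q0b f d by fastforce
  qed (use d finQ0 A.L_pos in auto)
  have Sm: "finite S" "L \<in> S" and Tm: "finite T" "L \<in> T" "- 1 \<in> T" "T \<subseteq> {- 1..}"
    "\<And>s. - 1 \<le> s \<Longrightarrow> s \<le> L \<Longrightarrow> \<exists>t\<in>T. s \<le> t \<and> t \<le> s + \<delta>"
    using S(1) T(1) by (auto simp: mesh_def)
  obtain B where B: "A.barcode S B" by (rule A.barcode_exists[OF Sm(1)])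
  obtain C where C: "B.barcode T C" by (rule B.barcode_exists[OF Tm(1)])
  have entS: "entry Z S b \<le> t \<longleftrightarrow> b \<in> Z t" "entry N S b \<le> t \<longleftrightarrow> b \<in> N t" if "t \<in> S" for t b
    using entry_le_iff[of S L Z t b, OF Sm A.Z_top[OF order_refl] A.Z_mono that]
      entry_le_iff[of S L N t b, OF Sm A.N_top[OF order_refl] A.N_mono that] by auto
  have entT: "entry Z' T c \<le> t \<longleftrightarrow> c \<in> Z' t" "entry N' T c \<le> t \<longleftrightarrow> c \<in> N' t" if "t \<in> T" for t c
    using entry_le_iff[of T L Z' t c, OF Tm(1,2) B.Z_top[OF order_refl] B.Z_mono that]
      entry_le_iff[of T L N' t c, OF Tm(1,2) B.N_top[OF order_refl] B.N_mono that] by auto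
  define bx where "bx p = A.bars B (fst p - e) (fst p + e) (snd p - e) (snd p + e)" for p
  define X where "X = (\<Union>p\<in>P0. bx p)"
  have inS: "fst p - e \<in> S" "fst p + e \<in> S" "snd p - e \<in> S" "snd p + e \<in> S" if "p \<in> P0" for p
    using S(2) that by auto
  have lt: "fst p + e < snd p - e" if "p \<in> P0" for p
    using P0b(1)[OF that] e d eta eps by linarith
  have bx: "finite (bx p)" "A.mult (fst p) (snd p) \<le> card (bx p)" if "p \<in> P0" for p
  proof -
    show "finite (bx p)" unfolding bx_def
      by (rule A.card_bars(1)[OF B]) (use inS[OF that] lt[OF that] e in auto)
    have "int (A.mult (fst p) (snd p)) \<le> A.box (fst p - e) (fst p + e) (snd p - e) (snd p + e)"
      by (rule A.mult_le_box) (use lt[OF that] e in auto)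
    also have "\<dots> = int (card (bx p))" unfolding bx_def
      by (rule A.card_bars(2)[OF B, symmetric]) (use inS[OF that] lt[OF that] e in auto)
    finally show "A.mult (fst p) (snd p) \<le> card (bx p)" by simp
  qed
  have near: "\<bar>entry Z S b - fst p\<bar> \<le> e" "\<bar>entry N S b - snd p\<bar> \<le> e" if "p \<in> P0" "b \<in> bx p" for p b
    using that(2) entS(1)[OF inS(1)[OF that(1)], of b] entS(1)[OF inS(2)[OF that(1)], of b]
      entS(2)[OF inS(3)[OF that(1)], of b] entS(2)[OF inS(4)[OF that(1)], of b]
    unfolding bx_def A.bars_def by auto
  have disj: "bx p \<inter> bx q = {}" if "p \<in> P0" "q \<in> P0" "p \<noteq> q" for p q
  proof (rule ccontr)
    assume "bx p \<inter> bx q \<noteq> {}"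
    then obtain b where "b \<in> bx p" "b \<in> bx q" by auto
    then show False
      using near[OF that(1), of b] near[OF that(2), of b] e(3)[of "(p, q)"] that by auto
  qed
  have "(\<Sum>(u, v)\<in>P. A.mult u v) = (\<Sum>p\<in>P0. A.mult (fst p) (snd p))"
    unfolding case_prod_beta P0_def
    by (rule sum.mono_neutral_right) (use P in auto)
  also have "\<dots> \<le> (\<Sum>p\<in>P0. card (bx p))" by (rule sum_mono) (rule bx(2))
  also have "\<dots> = card X" unfolding X_def
    by (rule card_UN_disjoint[symmetric]) (use P0 bx disj in auto)
  finally have 1: "(\<Sum>(u, v)\<in>P. A.mult u v) \<le> card X" .
  have X: "finite X" "X \<subseteq> B" using P0 bx by (auto simp: X_def bx_def A.bars_def)
  obtain Y where Y: "finite Y" "Y \<subseteq> C" "card X \<le> card Y"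
    "\<forall>c\<in>Y. \<exists>b\<in>X. \<bar>entry Z S b - entry Z' T c\<bar> \<le> \<epsilon> + \<delta> \<and>
       \<bar>entry N S b - entry N' T c\<bar> \<le> \<epsilon> + \<delta>"
    by (rule barcodes_neighbours[OF S(1) T(1) less_imp_le[OF d(1)] B C X])
  define by' where "by' q = B.bars C (fst q - f) (fst q + f) (snd q - f) (snd q + f)" for q
  have inT: "fst q - f \<in> T" "fst q + f \<in> T" "snd q - f \<in> T" "snd q + f \<in> T" if "q \<in> Q0" for q
    using T(2) that by auto
  have byc: "finite (by' q)" "card (by' q) = B.mult (fst q) (snd q)" if "q \<in> Q0" for q
  proof -
    show "finite (by' q)" unfolding by'_def
      by (rule B.card_bars(1)[OF C]) (use inT[OF that] f(3)[OF that] f(1) in auto)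
    have "int (card (by' q)) = B.box (fst q - f) (fst q + f) (snd q - f) (snd q + f)"
      unfolding by'_def by (rule B.card_bars(2)[OF C]) (use inT[OF that] f(3)[OF that] f(1) in auto)
    then show "card (by' q) = B.mult (fst q) (snd q)" using f(3)[OF that] by simp
  qed
  \<comment> \<open>The sampled birth \<open>x\<close> and death \<open>y\<close> of the bar, with
    their predecessors \<open>a\<close> and \<open>c'\<close> in \<open>T\<close>, bound a window
    with sides at most \<open>2 * \<delta>\<close> and a positive count. By \<open>box_eq_0\<close>
    the window contains a point of the diagram; it belongs to \<open>Q\<close>, and its tiny box
    contains the bar.\<close>
  have cover: "\<exists>q\<in>Q \<inter> Q0. c \<in> by' q" if c: "c \<in> Y" for c
  proof -
    define x where "x = entry Z' T c"
    define y where "y = entry N' T c"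
    obtain b p where bp: "p \<in> P0" "b \<in> bx p" "\<bar>entry Z S b - x\<bar> \<le> \<epsilon> + \<delta>" "\<bar>entry N S b - y\<bar> \<le> \<epsilon> + \<delta>"
      using bspec[OF Y(4) c] by (auto simp: X_def x_def y_def)
    have xu: "\<bar>x - fst p\<bar> \<le> \<epsilon> + 2 * \<delta>" and yv: "\<bar>y - snd p\<bar> \<le> \<epsilon> + 2 * \<delta>"
      using near[OF bp(1,2)] bp(3,4) e(2) by linarith+
    have xy: "12 * \<delta> < y - x" using xu yv P0b(1)[OF bp(1)] d by linarith
    have xyT: "x \<in> T" "c \<in> Z' x" "y \<in> T" "c \<in> N' y" "y \<le> L"
      using entry[OF Tm(1,2), of Z' c] entry[OF Tm(1,2), of N' c] B.Z_top B.N_top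
      by (auto simp: x_def y_def)
    have x1: "- 1 \<le> x" using xyT Tm(4) by auto
    define c' where "c' = Max {t \<in> T. t < y}"
    have "- 1 \<in> {t \<in> T. t < y}" using Tm(3) xy x1 d by auto
    then have "c' \<in> {t \<in> T. t < y}" unfolding c'_def using Tm(1) by (intro Max_in) auto
    then have c': "c' \<in> T" "c' < y" by auto
    have c'max: "t \<le> c'" if "t \<in> T" "t < y" for t
      unfolding c'_def using Tm(1) that by (intro Max_ge) auto
    have c'y: "y - 2 * \<delta> \<le> c'"
    proof -
      \<comment> \<open>Aiming at \<open>y - 2 * \<delta>\<close> yields a sampling time at most
        \<open>y - \<delta>\<close>, hence strictly before \<open>y\<close>.\<close>
      obtain t where t: "t \<in> T" "y - 2 * \<delta> \<le> t" "t \<le> y - 2 * \<delta> + \<delta>"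
        using Tm(5)[of "y - 2 * \<delta>"] xy x1 d xyT(5) by auto
      then show ?thesis using c'max[of t] d by linarith
    qed
    have nN: "c \<notin> N' c'" using entT(2)[OF c'(1), of c] c'(2) by (simp add: y_def)
    have cC: "c \<in> C" using Y(2) c by blast
    \<comment> \<open>A bar present at time -1 would be a class at a negative time surviving to
      \<open>c'\<close>, against \<open>rk_neg\<close>.\<close>
    have x1': "- 1 < x"
    proof (rule ccontr)
      assume "\<not> - 1 < x"
      then have "x = - 1" using x1 by simp
      moreover have "- 1 < c'" using c'y xy x1 d by linarith
      ultimately have "card ((C \<inter> Z' x) - N' c') = 0" "finite ((C \<inter> Z' x) - N' c')"
        using B.barcode_rk[OF C xyT(1) c'(1)] B.rk_neg[of x c'] by auto
      then show False using cC nN xyT(2) by auto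
    qed
    define a where "a = Max {t \<in> T. t < x}"
    have "- 1 \<in> {t \<in> T. t < x}" using Tm(3) x1' by auto
    then have "a \<in> {t \<in> T. t < x}" unfolding a_def using Tm(1) by (intro Max_in) auto
    then have a: "a \<in> T" "a < x" by auto
    have amax: "t \<le> a" if "t \<in> T" "t < x" for t
      unfolding a_def using Tm(1) that by (intro Max_ge) auto
    have ax: "x - 2 * \<delta> \<le> a"
    proof (cases "x - 2 * \<delta> < - 1")
      case True
      then show ?thesis using a(1) Tm(4) by auto
    next
      case False
      then obtain t where t: "t \<in> T" "x - 2 * \<delta> \<le> t" "t \<le> x - 2 * \<delta> + \<delta>"
        using Tm(5)[of "x - 2 * \<delta>"] xy d xyT(5) by auto
      then show ?thesis using amax[of t] d by linarith
    qed
    have nZ: "c \<notin> Z' a" using entT(1)[OF a(1), of c] a(2) by (simp add: x_def)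
    have xc': "x < c'" using c'y xy d by linarith
    have "c \<in> B.bars C a x c' y" using cC nZ nN xyT by (simp add: B.bars_def)
    moreover have "finite (B.bars C a x c' y)" "int (card (B.bars C a x c' y)) = B.box a x c' y"
      by (intro B.card_bars[OF C]; use a c' xc' xyT in simp)+
    ultimately have "B.box a x c' y \<noteq> 0" by auto
    then obtain qx qy where q: "a \<le> qx" "qx \<le> x" "c' \<le> qy" "qy \<le> y" "B.mult qx qy \<noteq> 0"
      using B.box_eq_0[of a x c' y] a c' xc' by auto
    have qQ0: "(qx, qy) \<in> Q0" using q c'y xy d by (auto simp: Q0_def)
    have "\<bar>qx - fst p\<bar> \<le> \<eta>" "\<bar>qy - snd p\<bar> \<le> \<eta>"
      using q xu yv ax c'y d by linarith+
    then have qQ: "(qx, qy) \<in> Q"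
      using q xc' bp(1) P0(2) unfolding Q_def by (auto intro!: bexI[of _ p])
    \<comment> \<open>No time of \<open>T\<close> lies strictly between \<open>a\<close> and
      \<open>x\<close>, nor between \<open>c'\<close> and \<open>y\<close>. The sides of the tiny
      box are times of \<open>T\<close>, so \<open>qx + f\<close>, being later than
      \<open>a\<close>, is not before \<open>x\<close>; likewise \<open>qy + f\<close> is not before
      \<open>y\<close>.\<close>
    have "c \<in> by' (qx, qy)"
    proof -
      have "c \<notin> Z' (qx - f)" using entT(1)[OF inT(1)[OF qQ0], of c] q f by (simp add: x_def)
      moreover have "c \<in> Z' (qx + f)"
        using entT(1)[OF inT(2)[OF qQ0], of c] amax[of "qx + f"] inT(2)[OF qQ0] q f by (force simp: x_def)
      moreover have "c \<notin> N' (qy - f)" using entT(2)[OF inT(3)[OF qQ0], of c] q f by (simp add: y_def)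
      moreover have "c \<in> N' (qy + f)"
        using entT(2)[OF inT(4)[OF qQ0], of c] c'max[of "qy + f"] inT(4)[OF qQ0] q f by (force simp: y_def)
      ultimately show ?thesis using cC by (simp add: by'_def B.bars_def)
    qed
    then show ?thesis using qQ qQ0 by blast
  qed
  have "card Y \<le> card (\<Union>q\<in>Q \<inter> Q0. by' q)"
    by (rule card_mono) (use finQ cover byc in auto)
  also have "\<dots> \<le> (\<Sum>q\<in>Q \<inter> Q0. card (by' q))" by (rule card_UN_le) (use finQ in auto)
  also have "\<dots> = (\<Sum>q\<in>Q \<inter> Q0. B.mult (fst q) (snd q))" by (rule sum.cong) (auto simp: byc)
  also have "\<dots> \<le> (\<Sum>q\<in>Q. B.mult (fst q) (snd q))" by (rule sum_mono2) (use finQ in auto)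
  finally show "(\<Sum>(u, v)\<in>P. A.mult u v) \<le> (\<Sum>(x, y)\<in>Q. B.mult x y)"
    using 1 Y(3) by (simp add: case_prod_beta)
qed

end

section \<open>Matchings and the bottleneck distance\<close>

text \<open>The induction of Halmos and Vaughan. If a nonempty proper subset \<open>J\<close> is
  tight, it is matched first and the rest outside its neighbours; otherwise every nonempty proper
  subset has slack, and an arbitrary admissible pair can be removed.\<close>

lemma hall_marriage:
  assumes "finite I" "\<And>i. i \<in> I \<Longrightarrow> finite (S i)" "\<And>J. J \<subseteq> I \<Longrightarrow> card J \<le> card (\<Union>(S ` J))"
  shows "\<exists>f. inj_on f I \<and> (\<forall>i\<in>I. f i \<in> S i)"
  using assms
proof (induction "card I" arbitrary: I S rule: less_induct)
  case less
  show ?case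
  proof (cases "\<exists>J. J \<noteq> {} \<and> J \<subset> I \<and> card (\<Union>(S ` J)) = card J")
    case True
    then obtain J where J: "J \<noteq> {}" "J \<subset> I" "card (\<Union>(S ` J)) = card J" by blast
    let ?U = "\<Union>(S ` J)"
    have fJ: "finite J" using J less.prems(1) finite_subset by blast
    have "\<exists>f. inj_on f J \<and> (\<forall>i\<in>J. f i \<in> S i)"
    proof (rule less.hyps)
      show "card J < card I" using J less.prems(1) by (simp add: psubset_card_mono)
      show "card K \<le> card (\<Union>(S ` K))" if "K \<subseteq> J" for K
        using that J by (intro less.prems(3)) auto
    qed (use J less.prems fJ in auto)
    then obtain f where f: "inj_on f J" "\<And>i. i \<in> J \<Longrightarrow> f i \<in> S i" by blast
    have "\<exists>g. inj_on g (I - J) \<and> (\<forall>i\<in>I - J. g i \<in> S i - ?U)"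
    proof (rule less.hyps)
      show "card (I - J) < card I" using J less.prems(1) by (intro psubset_card_mono) auto
      show "card K \<le> card (\<Union>((\<lambda>i. S i - ?U) ` K))" if K: "K \<subseteq> I - J" for K
      proof -
        have fK: "finite K" using K less.prems(1) finite_subset by blast
        have KJ: "K \<union> J \<subseteq> I" using K J by auto
        have "card K + card J = card (K \<union> J)"
          using K fK fJ by (intro card_Un_disjoint[symmetric]) auto
        also have "\<dots> \<le> card (\<Union>(S ` (K \<union> J)))" by (rule less.prems(3)[OF KJ])
        also have "\<Union>(S ` (K \<union> J)) = \<Union>((\<lambda>i. S i - ?U) ` K) \<union> ?U" by auto
        also have "card \<dots> \<le> card (\<Union>((\<lambda>i. S i - ?U) ` K)) + card ?U" by (rule card_Un_le)
        finally show ?thesis using J(3) by simp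
      qed
    qed (use less.prems in auto)
    then obtain g where g: "inj_on g (I - J)" "\<And>i. i \<in> I - J \<Longrightarrow> g i \<in> S i - ?U" by blast
    define h where "h i = (if i \<in> J then f i else g i)" for i
    have "inj_on h I"
      using f g unfolding inj_on_def h_def by (smt (verit) DiffD2 DiffI UN_I)
    moreover have "\<forall>i\<in>I. h i \<in> S i" using f g by (auto simp: h_def)
    ultimately show ?thesis by blast
  next
    case False
    show ?thesis
    proof (cases "I = {}")
      case True
      then show ?thesis by simp
    next
      case False
      then obtain i where i: "i \<in> I" by blast
      have "card {i} \<le> card (S i)" using less.prems(3)[of "{i}"] i by simp
      then obtain x where x: "x \<in> S i" by fastforce
      have "\<exists>f. inj_on f (I - {i}) \<and> (\<forall>j\<in>I - {i}. f j \<in> S j - {x})"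
      proof (rule less.hyps)
        show "card (I - {i}) < card I" using i less.prems(1) by (intro psubset_card_mono) auto
        show "card K \<le> card (\<Union>((\<lambda>j. S j - {x}) ` K))" if K: "K \<subseteq> I - {i}" for K
        proof (cases "K = {}")
          case False
          have KI: "K \<subset> I" using K i by auto
          have "card K \<noteq> card (\<Union>(S ` K))"
            using \<open>\<not> (\<exists>J. J \<noteq> {} \<and> J \<subset> I \<and> card (\<Union>(S ` J)) = card J)\<close> False KI by metis
          then have "card K < card (\<Union>(S ` K))" using less.prems(3)[of K] KI by auto
          moreover have "card (\<Union>(S ` K)) - 1 \<le> card (\<Union>(S ` K) - {x})"
            by (simp add: diff_card_le_card_Diff[of "{x}" "\<Union>(S ` K)"] card_Diff_singleton_if)
          moreover have "\<Union>((\<lambda>j. S j - {x}) ` K) = \<Union>(S ` K) - {x}" by auto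
          ultimately show ?thesis by simp
        qed simp
      qed (use less.prems in auto)
      then obtain f where f: "inj_on f (I - {i})" "\<And>j. j \<in> I - {i} \<Longrightarrow> f j \<in> S j - {x}" by blast
      have "inj_on (f(i := x)) I" using f by (auto simp: inj_on_def)
      moreover have "\<forall>j\<in>I. (f(i := x)) j \<in> S j" using f x by auto
      ultimately show ?thesis by blast
    qed
  qed
qed

text \<open>By the extra conclusion each pair of the bijection comes from \<open>f\<close>, or from
  \<open>g\<close> read backwards, so it inherits any symmetric cost bound that both injections
  satisfy.\<close>

lemma Schroeder_Bernstein_refined:
  assumes f: "inj_on f A" "f ` A \<subseteq> B" and g: "inj_on g B" "g ` B \<subseteq> A"
  obtains h where "bij_betw h A B" "\<And>a. a \<in> A \<Longrightarrow> h a = f a \<or> g (h a) = a"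
proof -
  \<comment> \<open>The orbit under \<open>g \<circ> f\<close> of the elements that \<open>g\<close>
    misses: on it \<open>f\<close> is used, elsewhere \<open>g\<close> is inverted.\<close>
  define W where "W = lfp (\<lambda>X. (A - g ` B) \<union> g ` f ` (X \<inter> A))"
  have "mono (\<lambda>X. (A - g ` B) \<union> g ` f ` (X \<inter> A))" by (auto simp: mono_def)
  then have W0: "W = (A - g ` B) \<union> g ` f ` (W \<inter> A)"
    unfolding W_def by (rule lfp_unfold)
  have WA: "W \<subseteq> A" using f g by (subst W0) auto
  have W: "W = (A - g ` B) \<union> g ` f ` W" using W0 WA by (simp add: Int_absorb2)
  have c: "A - W = g ` (B - f ` W)"
  proof (intro equalityI subsetI)
    fix a assume a: "a \<in> A - W"
    then obtain b where b: "b \<in> B" "a = g b" using W by blast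
    then have "b \<notin> f ` W" using a W by blast
    then show "a \<in> g ` (B - f ` W)" using b by blast
  next
    fix a assume "a \<in> g ` (B - f ` W)"
    then obtain b where b: "b \<in> B" "b \<notin> f ` W" "a = g b" by blast
    have "a \<notin> g ` f ` W"
    proof
      assume "a \<in> g ` f ` W"
      then obtain x where x: "x \<in> W" "g b = g (f x)" using b(3) by auto
      then have "f x \<in> B" using WA f(2) by blast
      then have "b = f x" using inj_onD[OF g(1) x(2) b(1)] by blast
      then show False using b x by blast
    qed
    then have "a \<notin> W" using W b by blast
    then show "a \<in> A - W" using b g(2) by blast
  qed
  define h where "h a = (if a \<in> W then f a else inv_into B g a)" for a
  have ginv: "inv_into B g (g b) = b" if "b \<in> B" for b using that g(1) by simp
  have h1: "bij_betw h W (f ` W)"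
    using f(1) WA unfolding bij_betw_def h_def by (auto simp: inj_on_def)
  have h2: "bij_betw h (A - W) (B - f ` W)"
  proof (rule bij_betw_imageI)
    have hg: "h (g b) = b" if "b \<in> B - f ` W" for b
    proof -
      have "g b \<in> A - W" unfolding c using that by blast
      then show ?thesis using ginv that by (simp add: h_def)
    qed
    show "inj_on h (A - W)" unfolding c by (rule inj_onI) (auto simp: hg)
    show "h ` (A - W) = B - f ` W" unfolding c image_image by (simp add: hg)
  qed
  have "bij_betw h (W \<union> (A - W)) (f ` W \<union> (B - f ` W))"
    by (rule bij_betw_combine[OF h1 h2]) auto
  moreover have "W \<union> (A - W) = A" "f ` W \<union> (B - f ` W) = B" using WA f(2) by auto
  ultimately have "bij_betw h A B" by simp
  moreover have "h a = f a \<or> g (h a) = a" if "a \<in> A" for a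
  proof (cases "a \<in> W")
    case False
    then have "a \<in> g ` B" using c that by auto
    then show ?thesis using False by (auto simp: h_def f_inv_into_f)
  qed (simp add: h_def)
  ultimately show ?thesis by (rule that)
qed

text \<open>Gives every labelled point a diagonal point of its own, so that near points can be moved
  to the diagonal injectively.\<close>

lemma inj_point_label_real: "\<exists>\<psi> :: (real \<times> ereal) \<times> nat \<Rightarrow> real. inj \<psi>"
proof -
  have "(card_of (UNIV \<times> UNIV :: (real \<times> real) set), card_of (UNIV :: real set)) \<in> ordIso"
    by (rule card_of_Times_same_infinite) (rule infinite_UNIV_char_0)
  then have "(card_of (UNIV :: (real \<times> real) set), card_of (UNIV :: real set)) \<in> ordLeq"
    by (simp add: ordIso_imp_ordLeq)
  then obtain p :: "real \<times> real \<Rightarrow> real" where p: "inj p"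
    unfolding card_of_ordLeq[symmetric] by auto
  have pe: "p q = p q' \<longleftrightarrow> q = q'" for q q' using p by (simp add: inj_eq)
  define c where "c w = (case w of ereal r \<Rightarrow> p (r, 0) | PInfty \<Rightarrow> p (0, 1) | MInfty \<Rightarrow> p (0, 2))" for w
  have c: "c w = c w' \<longleftrightarrow> w = w'" for w w'
    by (cases w; cases w') (simp_all add: c_def pe)
  have "inj (\<lambda>((u, w), i). p (p (u, c w), real i))"
    by (rule injI) (auto simp: pe c)
  then show ?thesis by blast
qed

lemma dstar_commute: "dstar p q = dstar q p"
  unfolding dstar_def by (auto split: prod.splits ereal.splits simp: abs_minus_commute max.commute)

text \<open>By the second term in the minimum defining dstar, points of persistence at most 2 \<eta> may be
  paired with each other arbitrarily at cost \<eta>; only the far points need a matching.\<close>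

definition far :: "real \<Rightarrow> (real \<times> ereal) \<times> nat \<Rightarrow> bool" where
  "far \<eta> a \<longleftrightarrow> ereal (fst (fst a) + 2 * \<eta>) < snd (fst a)"

text \<open>Far points follow \<open>f\<close>, the others go to private diagonal points. The two
  kinds of images cannot collide, because \<open>f\<close> stays strictly above the
  diagonal.\<close>

lemma extend_to_diagonal:
  assumes f: "inj_on f {a \<in> aug m1. far \<eta> a}"
    "\<And>a. a \<in> aug m1 \<Longrightarrow> far \<eta> a \<Longrightarrow> f a \<in> aug m2 \<and> ereal (fst (fst (f a))) < snd (fst (f a)) \<and>
       dstar (fst a) (fst (f a)) \<le> ereal \<eta>"
  obtains F where "inj_on F (aug m1)" "F ` aug m1 \<subseteq> aug m2"
    "\<And>a. a \<in> aug m1 \<Longrightarrow> dstar (fst a) (fst (F a)) \<le> ereal \<eta>"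
proof -
  obtain \<psi> :: "(real \<times> ereal) \<times> nat \<Rightarrow> real" where \<psi>: "inj \<psi>"
    using inj_point_label_real by blast
  define F where "F a = (if far \<eta> a then f a else ((\<psi> a, ereal (\<psi> a)), 0))" for a
  have "inj_on F (aug m1)"
  proof (rule inj_onI)
    fix a b assume a: "a \<in> aug m1" and b: "b \<in> aug m1" and e: "F a = F b"
    have "far \<eta> c \<longleftrightarrow> ereal (fst (fst (F c))) < snd (fst (F c))" if "c \<in> aug m1" for c
      using f(2)[OF that] by (simp add: F_def)
    then have "far \<eta> a \<longleftrightarrow> far \<eta> b" using a b e by simp
    then show "a = b"
      using e f(2)[OF a] f(2)[OF b] inj_onD[OF f(1), of a b] a b injD[OF \<psi>, of a b]
      by (cases "far \<eta> a"; cases "far \<eta> b") (auto simp: F_def)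
  qed
  moreover have "((r, ereal r), 0) \<in> aug m2" for r by (simp add: aug_def)
  then have "F ` aug m1 \<subseteq> aug m2" using f(2) by (auto simp: F_def)
  moreover have "dstar (fst a) (fst (F a)) \<le> ereal \<eta>" if a: "a \<in> aug m1" for a
  proof (cases "far \<eta> a")
    case True
    then show ?thesis using f(2)[OF a] by (simp add: F_def)
  next
    case False
    obtain u w i where aw: "a = ((u, w), i)" by (metis prod.exhaust)
    have "w \<le> ereal (u + 2 * \<eta>)" "ereal u \<le> w" using False a by (auto simp: far_def aw aug_def)
    then obtain y where y: "w = ereal y" "y \<le> u + 2 * \<eta>" "u \<le> y" by (cases w) auto
    show ?thesis using False y by (simp add: F_def dstar_def aw min.coboundedI2)
  qed
  ultimately show ?thesis by (rule that)
qed

lemma dmatch_le: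
  assumes f: "inj_on f {a \<in> aug m1. far \<eta> a}"
    "\<And>a. a \<in> aug m1 \<Longrightarrow> far \<eta> a \<Longrightarrow> f a \<in> aug m2 \<and> ereal (fst (fst (f a))) < snd (fst (f a)) \<and>
       dstar (fst a) (fst (f a)) \<le> ereal \<eta>"
    and g: "inj_on g {a \<in> aug m2. far \<eta> a}"
    "\<And>a. a \<in> aug m2 \<Longrightarrow> far \<eta> a \<Longrightarrow> g a \<in> aug m1 \<and> ereal (fst (fst (g a))) < snd (fst (g a)) \<and>
       dstar (fst a) (fst (g a)) \<le> ereal \<eta>"
  shows "dmatch m1 m2 \<le> ereal \<eta>"
proof -
  obtain F where F: "inj_on F (aug m1)" "F ` aug m1 \<subseteq> aug m2"
    "\<And>a. a \<in> aug m1 \<Longrightarrow> dstar (fst a) (fst (F a)) \<le> ereal \<eta>"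
    by (rule extend_to_diagonal[OF f]) auto
  obtain K where K: "inj_on K (aug m2)" "K ` aug m2 \<subseteq> aug m1"
    "\<And>a. a \<in> aug m2 \<Longrightarrow> dstar (fst a) (fst (K a)) \<le> ereal \<eta>"
    by (rule extend_to_diagonal[OF g]) auto
  obtain h where h: "bij_betw h (aug m1) (aug m2)" "\<And>a. a \<in> aug m1 \<Longrightarrow> h a = F a \<or> K (h a) = a"
    by (rule Schroeder_Bernstein_refined[OF F(1,2) K(1,2)]) auto
  have "dstar (fst a) (fst (h a)) \<le> ereal \<eta>" if a: "a \<in> aug m1" for a
    using h(2)[OF a] F(3)[OF a] K(3)[of "h a"] bij_betwE[OF h(1)] a by (metis dstar_commute)
  then have "(SUP a\<in>aug m1. dstar (fst a) (fst (h a))) \<le> ereal \<eta>" by (rule SUP_least)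
  then show ?thesis unfolding dmatch_def using h(1) by (intro INF_lower2[of h]) auto
qed

section \<open>Stability\<close>

lemma (in vector_space) quot_rank_eq_0:
  assumes "Z \<subseteq> N" "subspace N"
  shows "quot_rank Z N = 0"
proof -
  have "quot_rank Z N \<le> 0"
    unfolding quot_rank_def
  proof (rule Sup_least, clarify)
    fix n and hs :: "nat \<Rightarrow> 'b"
    assume hs: "\<forall>i<n. hs i \<in> Z" and c: "\<forall>c. (\<Sum>i<n. c i *s hs i) \<in> N \<longrightarrow> (\<forall>i<n. c i = (0::'a))"
    have "(\<Sum>i<n. 1 *s hs i) \<in> N"
      using hs assms by (intro subspace_sum subspace_scale) auto
    then have "\<forall>i<n. (1::'a) = 0" by (rule c[THEN spec, of "\<lambda>_. 1", THEN mp])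
    then have "n = 0" by auto
    then show "enat n \<le> 0" by (simp add: zero_enat_def)
  qed
  then show ?thesis by simp
qed

lemma (in vector_space) quot_rank_UNIV: "quot_rank Z UNIV = 0"
  by (rule quot_rank_eq_0) (auto simp: subspace_UNIV)

text \<open>Replacing both families by UNIV from some large time L on turns an essential class born at u
  into a bar from u to L, so that points at infinity need no separate treatment.\<close>

definition cap :: "real \<Rightarrow> (real \<Rightarrow> 'b set) \<Rightarrow> real \<Rightarrow> 'b set" where
  "cap L F t = (if L \<le> t then UNIV else F t)"

text \<open>Finite deaths that occur in the diagram are at most \<open>M\<close>, so for
  \<open>M < L\<close> the value \<open>L\<close> stands for an infinite death without
  ambiguity.\<close>

definition flat :: "real \<Rightarrow> ereal \<Rightarrow> real" where
  "flat L w = (if w = \<infinity> then L else real_of_ereal w)"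

definition unflat :: "real \<Rightarrow> real \<Rightarrow> ereal" where
  "unflat L y = (if y = L then \<infinity> else ereal y)"

lemma flat_simps [simp]: "flat L (ereal v) = v" "flat L \<infinity> = L"
  by (auto simp: flat_def)

lemma diagram_simps:
  "diagram r (u, ereal v) = (if u < v then mult_proper r u v else 0)"
  "diagram r (u, \<infinity>) = mult_inf r u"
  by (auto simp: diagram_def)

locale bounded_filtration = tame_filtration scale Z N
  for scale :: "'a::field \<Rightarrow> 'b::ab_group_add \<Rightarrow> 'b" (infixr "*s" 75) and Z N +
  fixes M :: real
  assumes M_nonneg: "0 \<le> M"
    and Z_const: "M \<le> t \<Longrightarrow> Z t = Z M" and N_const: "M \<le> t \<Longrightarrow> N t = N M"
    and rk_neg: "u < 0 \<Longrightarrow> u < v \<Longrightarrow> rk u v = 0"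
begin

lemma rk_cap:
  assumes "u < v"
  shows "the_enat (quot_rank (cap L Z u) (cap L N v)) = (if v < L then rk u v else 0)"
  using assms by (auto simp: cap_def rk_def quot_rank_UNIV zero_enat_def)

lemma capped:
  assumes "M < L"
  shows "capped_filtration scale (cap L Z) (cap L N) L"
proof -
  interpret C: tame_filtration scale "cap L Z" "cap L N"
  proof
    show "subspace (cap L Z t)" "subspace (cap L N t)" for t
      by (auto simp: cap_def subspace_UNIV subspace_Z subspace_N)
    show "cap L Z s \<subseteq> cap L Z t" "cap L N s \<subseteq> cap L N t" if "s \<le> t" for s t
      using Z_mono[OF that] N_mono[OF that] that by (auto simp: cap_def)
    have "(0::enat) \<noteq> \<infinity>" by simp
    then show "quot_rank (cap L Z u) (cap L N v) \<noteq> \<infinity>" if "u < v" for u v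
      using tame[OF that] that unfolding cap_def by (auto simp only: quot_rank_UNIV split: if_splits)
  qed
  show ?thesis
  proof
    show "0 < L" using M_nonneg assms by simp
    show "C.rk u v = 0" if "u < 0" "u < v" for u v
      unfolding C.rk_def using rk_cap[OF that(2)] rk_neg[OF that] by simp
  qed (auto simp: cap_def)
qed

definition capmult :: "real \<Rightarrow> real \<Rightarrow> real \<Rightarrow> nat" where
  "capmult L = tame_filtration.mult scale (cap L Z) (cap L N)"

lemma capmult_eq_mult:
  assumes L: "M < L" "u < v" "v < L"
  shows "capmult L u v = mult u v"
proof -
  interpret C: capped_filtration scale "cap L Z" "cap L N" L by (rule capped[OF L(1)])
  obtain e1 where e1: "e1 > 0" "\<And>e. 0 < e \<and> e \<le> e1 \<Longrightarrow> u + e < v - e \<and>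
      box (u - e) (u + e) (v - e) (v + e) = int (mult u v)"
    using mult_box[OF L(2)] by blast
  obtain e2 where e2: "e2 > 0" "\<And>e. 0 < e \<and> e \<le> e2 \<Longrightarrow> u + e < v - e \<and>
      C.box (u - e) (u + e) (v - e) (v + e) = int (C.mult u v)"
    using C.mult_box[OF L(2)] by blast
  define e where "e = min (min e1 e2) ((L - v) / 2)"
  have e: "0 < e" "e \<le> e1" "e \<le> e2" "v + e < L"
    using e1(1) e2(1) L by (auto simp: e_def min_def field_simps)
  have lt: "u + e < v - e" using e1(2)[of e] e by simp
  have "C.box (u - e) (u + e) (v - e) (v + e) = box (u - e) (u + e) (v - e) (v + e)"
    unfolding C.box_def box_def C.rk_def using e lt by (simp add: rk_cap)
  then show ?thesis using e1(2)[of e] e2(2)[of e] e by (simp add: capmult_def)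
qed

lemma mult_above:
  assumes "u < v" "M < v"
  shows "mult u v = 0"
proof -
  obtain e0 where e0: "e0 > 0" "\<And>e. 0 < e \<and> e \<le> e0 \<Longrightarrow> u + e < v - e \<and>
      box (u - e) (u + e) (v - e) (v + e) = int (mult u v)"
    using mult_box[OF assms(1)] by blast
  define e where "e = min e0 (v - M)"
  have e: "0 < e" "e \<le> e0" "M \<le> v - e" "M \<le> v + e" using e0(1) assms by (auto simp: e_def)
  have "box (u - e) (u + e) (v - e) (v + e) = 0"
    unfolding box_def rk_def using N_const[OF e(3)] N_const[OF e(4)] by simp
  then show ?thesis using e0(2)[of e] e by simp
qed

text \<open>The differences count the bars born in (a, b] and alive at a given time: the one-sided
  analogue of \<open>box\<close> on which \<open>mult_inf\<close> is built.\<close>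

lemma strip_mono:
  assumes "a' \<le> a" "a \<le> b" "b \<le> b'" "b' < v" "v \<le> v'"
  shows "0 \<le> int (rk b v') - int (rk a v')"
    "int (rk b v') - int (rk a v') \<le> int (rk b' v) - int (rk a' v)"
proof -
  obtain B where B: "barcode {a, b, a', b', v, v'} B"
    by (rule barcode_exists[of "{a, b, a', b', v, v'}"]) auto
  have strip: "finite ((B \<inter> (Z q - Z p)) - N w) \<and>
      int (card ((B \<inter> (Z q - Z p)) - N w)) = int (rk q w) - int (rk p w)"
    if "p \<in> {a, b, a', b'}" "q \<in> {a, b, a', b'}" "w \<in> {v, v'}" "p \<le> q" for p q w
  proof -
    have lt: "p < w" "q < w" using that assms by auto
    have eq: "(B \<inter> (Z q - Z p)) - N w = ((B \<inter> Z q) - N w) - ((B \<inter> Z p) - N w)" by auto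
    have sub: "(B \<inter> Z p) - N w \<subseteq> (B \<inter> Z q) - N w" using Z_mono[OF that(4)] by auto
    have p: "finite ((B \<inter> Z p) - N w)" "card ((B \<inter> Z p) - N w) = rk p w"
      and q: "finite ((B \<inter> Z q) - N w)" "card ((B \<inter> Z q) - N w) = rk q w"
      using barcode_rk[OF B, of p w] barcode_rk[OF B, of q w] that lt by auto
    show ?thesis
      unfolding eq using card_Diff_subset[OF p(1) sub] card_mono[OF q(1) sub] p q by simp
  qed
  show "0 \<le> int (rk b v') - int (rk a v')" using strip[of a b v'] assms by auto
  have "card ((B \<inter> (Z b - Z a)) - N v') \<le> card ((B \<inter> (Z b' - Z a')) - N v)"
    using strip[of a' b' v] Z_mono[of a' a] Z_mono[of b b'] N_mono[of v v'] assms
    by (intro card_mono) auto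
  then show "int (rk b v') - int (rk a v') \<le> int (rk b' v) - int (rk a' v)"
    using strip[of a b v'] strip[of a' b' v] assms by auto
qed

text \<open>From \<open>L\<close> on the capped ranks vanish, so a small box around
  \<open>(u, L)\<close> counts bars born near \<open>u\<close> and alive just before
  \<open>L\<close>. As \<open>N\<close> is constant after \<open>M\<close>, these are the bars that
  never die.\<close>

lemma capmult_top:
  assumes L: "M < L" "u < L"
  shows "capmult L u L = mult_inf rk u"
proof -
  interpret C: capped_filtration scale "cap L Z" "cap L N" L by (rule capped[OF L(1)])
  define S where "S = {int (rk (u + e) v) - int (rk (u - e) v) | e v. 0 < e \<and> u + e < v}"
  have m: "mult_inf rk u = nat (Inf S)" unfolding mult_inf_def S_def ..
  obtain e0 where e0: "e0 > 0" "\<And>e. 0 < e \<and> e \<le> e0 \<Longrightarrow> u + e < L - e \<and>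
      C.box (u - e) (u + e) (L - e) (L + e) = int (C.mult u L)"
    using C.mult_box[OF L(2)] by blast
  have val: "u + e < L - e \<and> int (C.mult u L) = int (rk (u + e) (L - e)) - int (rk (u - e) (L - e))"
    if "0 < e" "e \<le> e0" for e
  proof
    show lt: "u + e < L - e" using e0(2)[of e] that by simp
    have "C.box (u - e) (u + e) (L - e) (L + e) = int (rk (u + e) (L - e)) - int (rk (u - e) (L - e))"
      unfolding C.box_def C.rk_def using that lt by (simp add: rk_cap)
    then show "int (C.mult u L) = int (rk (u + e) (L - e)) - int (rk (u - e) (L - e))"
      using e0(2)[of e] that by simp
  qed
  have "Inf S = int (C.mult u L)"
  proof (rule cInf_eq_minimum)
    show "int (C.mult u L) \<in> S" using val[of e0] e0(1) unfolding S_def by blast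
    fix s assume "s \<in> S"
    then obtain e v where ev: "s = int (rk (u + e) v) - int (rk (u - e) v)" "0 < e" "u + e < v"
      by (auto simp: S_def)
    \<comment> \<open>With \<open>d\<close> at most \<open>L - M\<close>, the time
      \<open>L - d\<close> lies where \<open>N\<close> is constant; raising it to \<open>v'\<close>,
      which is at least \<open>v\<close>, changes no rank.\<close>
    define d where "d = min (min e0 e) (L - M)"
    have d: "0 < d" "d \<le> e0" "d \<le> e" "M \<le> L - d" using e0(1) ev L by (auto simp: d_def)
    define v' where "v' = max v (L - d)"
    have "N v' = N (L - d)" using N_const[of v'] N_const[of "L - d"] d by (auto simp: v'_def)
    then have "int (C.mult u L) = int (rk (u + d) v') - int (rk (u - d) v')"
      using val[of d] d by (simp add: rk_def)
    also have "\<dots> \<le> s"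
      unfolding ev(1) by (rule strip_mono(2)) (use d ev in \<open>auto simp: v'_def\<close>)
    finally show "int (C.mult u L) \<le> s" .
  qed
  then show ?thesis using m by (simp add: capmult_def)
qed

lemma mult_inf_above:
  assumes "M < u"
  shows "mult_inf rk u = 0"
proof -
  define S where "S = {int (rk (u + e) v) - int (rk (u - e) v) | e v. 0 < e \<and> u + e < v}"
  have m: "mult_inf rk u = nat (Inf S)" unfolding mult_inf_def S_def ..
  have "0 \<le> s" if s: "s \<in> S" for s
  proof -
    obtain e v where ev: "s = int (rk (u + e) v) - int (rk (u - e) v)" "0 < e" "u + e < v"
      using s by (auto simp: S_def)
    show ?thesis
      unfolding ev(1) by (rule strip_mono(1)[of "u - e" "u - e" "u + e" "u + e" v v]) (use ev in auto)
  qed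
  then have b: "bdd_below S" by (rule bdd_belowI)
  \<comment> \<open>The radius \<open>u - M\<close> puts the earlier time exactly at
    \<open>M\<close>, after which \<open>Z\<close> is constant.\<close>
  have "rk (u + (u - M)) (2 * u - M + 1) = rk (u - (u - M)) (2 * u - M + 1)"
    unfolding rk_def using Z_const[of "u + (u - M)"] assms by simp
  then have "0 \<in> S" unfolding S_def
    using assms by (intro CollectI exI[of _ "u - M"] exI[of _ "2 * u - M + 1"]) auto
  then show ?thesis using cInf_lower[OF _ b, of 0] m by simp
qed

text \<open>Together with \<open>diagram_capmult\<close> this identifies the points above the
  diagonal before and after capping: \<open>(u, \<infinity>)\<close> sits at \<open>(u, L)\<close>,
  and the gap between \<open>M\<close> and \<open>L\<close> separates finite from infinite
  deaths.\<close>

lemma capmult_diagram: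
  assumes L: "M < L" and w: "ereal u < w" "diagram rk (u, w) > 0"
  shows "u < flat L w" "capmult L u (flat L w) = diagram rk (u, w)"
    "w = \<infinity> \<and> u \<le> M \<or> (\<exists>v\<le>M. w = ereal v)"
proof -
  consider "w = \<infinity>" | v where "w = ereal v" using w by (cases w) auto
  then have "u < flat L w \<and> capmult L u (flat L w) = diagram rk (u, w) \<and>
    (w = \<infinity> \<and> u \<le> M \<or> (\<exists>v\<le>M. w = ereal v))"
  proof cases
    case 1
    then have "\<not> M < u" using w mult_inf_above[of u] by (auto simp: diagram_simps)
    then show ?thesis using 1 L capmult_top[OF L, of u] by (simp add: diagram_simps)
  next
    case 2
    then have "u < v" "mult u v > 0" using w by (auto simp: diagram_simps mult_def)
    moreover then have "\<not> M < v" using mult_above[of u v] by auto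
    ultimately show ?thesis using 2 L capmult_eq_mult[OF L, of u v] by (simp add: diagram_simps mult_def)
  qed
  then show "u < flat L w" "capmult L u (flat L w) = diagram rk (u, w)"
    "w = \<infinity> \<and> u \<le> M \<or> (\<exists>v\<le>M. w = ereal v)" by auto
qed

lemma diagram_capmult:
  assumes L: "M < L" and xy: "x < y" "capmult L x y > 0"
  shows "diagram rk (x, unflat L y) = capmult L x y" "y = L \<or> y \<le> M"
proof -
  interpret C: capped_filtration scale "cap L Z" "cap L N" L by (rule capped[OF L])
  have "y \<le> L" using C.mult_support(2)[of x y] xy by (simp add: capmult_def)
  then consider "y = L" | "y < L" by linarith
  then have "diagram rk (x, unflat L y) = capmult L x y \<and> (y = L \<or> y \<le> M)"
  proof cases
    case 1
    then show ?thesis using capmult_top[OF L, of x] xy by (simp add: unflat_def diagram_simps)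
  next
    case 2
    then have "capmult L x y = mult x y" using capmult_eq_mult[OF L xy(1)] by simp
    moreover then have "\<not> M < y" using mult_above[OF xy(1)] xy(2) by auto
    ultimately show ?thesis using 2 xy by (simp add: unflat_def diagram_simps mult_def)
  qed
  then show "diagram rk (x, unflat L y) = capmult L x y" "y = L \<or> y \<le> M" by auto
qed

end

locale interleaved_bounded = A: bounded_filtration scale Z N M + B: bounded_filtration scale Z' N' M
  for scale :: "'a::field \<Rightarrow> 'b::ab_group_add \<Rightarrow> 'b" (infixr "*s" 75) and Z N Z' N' M +
  fixes \<epsilon> :: real
  assumes eps: "0 \<le> \<epsilon>"
    and Z_shift: "Z t \<subseteq> Z' (t + \<epsilon>)" "Z' t \<subseteq> Z (t + \<epsilon>)"
    and N_shift: "N t \<subseteq> N' (t + \<epsilon>)" "N' t \<subseteq> N (t + \<epsilon>)"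
begin

lemma far_matching:
  assumes eta: "\<epsilon> < \<eta>"
  shows "\<exists>f. inj_on f {a \<in> aug (diagram A.rk). far \<eta> a} \<and>
    (\<forall>a. a \<in> aug (diagram A.rk) \<longrightarrow> far \<eta> a \<longrightarrow> f a \<in> aug (diagram B.rk) \<and>
       ereal (fst (fst (f a))) < snd (fst (f a)) \<and> dstar (fst a) (fst (f a)) \<le> ereal \<eta>)"
proof -
  \<comment> \<open>The gap exceeds \<open>2 * \<eta>\<close>: a match within \<open>\<eta>\<close>
    cannot pair a finite death with \<open>L\<close>, and an essential class, born by time
    \<open>M\<close>, is far from the diagonal also after capping.\<close>
  define L where "L = M + 2 * \<eta> + 1"
  have L: "M < L" "M + 2 * \<eta> < L" using eps eta by (auto simp: L_def)
  interpret C: interleaved scale "cap L Z" "cap L N" "cap L Z'" "cap L N'" L \<epsilon>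
  proof (intro interleaved.intro A.capped B.capped L interleaved_axioms.intro eps)
    show "cap L Z t \<subseteq> cap L Z' (t + \<epsilon>)" "cap L Z' t \<subseteq> cap L Z (t + \<epsilon>)"
      "cap L N t \<subseteq> cap L N' (t + \<epsilon>)" "cap L N' t \<subseteq> cap L N (t + \<epsilon>)" for t
      using Z_shift[of t] N_shift[of t] eps by (auto simp: cap_def)
  qed
  define I where "I = {a \<in> aug (diagram A.rk). far \<eta> a}"
  define E :: "(real \<times> ereal) \<times> nat \<Rightarrow> (real \<times> real) \<times> nat"
    where "E a = ((fst (fst a), flat L (snd (fst a))), snd a)" for a
  define near where "near p q \<longleftrightarrow> \<bar>fst q - fst p\<bar> \<le> \<eta> \<and> \<bar>snd q - snd p\<bar> \<le> \<eta>" for p q :: "real \<times> real"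
  define Q where "Q P = {(x, y). x < y \<and> B.capmult L x y > 0 \<and>
     (\<exists>(u, v)\<in>P. \<bar>x - u\<bar> \<le> \<eta> \<and> \<bar>y - v\<bar> \<le> \<eta>)}" for P :: "(real \<times> real) set"
  \<comment> \<open>The candidates are copies of capped points, with labels below the multiplicity.
    Counting copies turns Hall's condition for \<open>S\<close> into the inequality of
    \<open>mult_hall\<close>.\<close>
  define S where "S a = {q. fst (fst q) < snd (fst q) \<and> snd q < B.capmult L (fst (fst q)) (snd (fst q)) \<and>
     near (fst (E a)) (fst q)}" for a
  have Id: "2 * \<eta> < snd (fst (E a)) - fst (fst (E a))" "snd a < A.capmult L (fst (fst (E a))) (snd (fst (E a)))"
    "snd (fst a) = \<infinity> \<or> (\<exists>v\<le>M. snd (fst a) = ereal v)" if a: "a \<in> I" for a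
  proof -
    obtain u w i where aw: "a = ((u, w), i)" by (metis prod.exhaust)
    have far: "ereal (u + 2 * \<eta>) < w" and aug: "a \<in> aug (diagram A.rk)"
      using a by (auto simp: I_def far_def aw)
    have "ereal u \<le> ereal (u + 2 * \<eta>)" using eps eta by simp
    then have uw: "ereal u < w" using far by (rule le_less_trans)
    then have i: "i < diagram A.rk (u, w)" using aug by (auto simp: aug_def aw)
    note d = A.capmult_diagram[OF L(1) uw]
    show "snd a < A.capmult L (fst (fst (E a))) (snd (fst (E a)))" using d(2) i by (simp add: E_def aw)
    show "snd (fst a) = \<infinity> \<or> (\<exists>v\<le>M. snd (fst a) = ereal v)" using d(3) i by (auto simp: aw)
    show "2 * \<eta> < snd (fst (E a)) - fst (fst (E a))"
      using d(3) i far L by (auto simp: E_def aw)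
  qed
  have injE: "inj_on E I"
  proof (rule inj_onI)
    fix a b assume ab: "a \<in> I" "b \<in> I" "E a = E b"
    then show "a = b"
      using Id(3)[OF ab(1)] Id(3)[OF ab(2)] L(1) by (auto simp: E_def prod_eq_iff)
  qed
  have card_le: "card J \<le> (\<Sum>(u, v)\<in>(\<lambda>a. fst (E a)) ` J. A.capmult L u v)" if J: "J \<subseteq> I" "finite J" for J
  proof -
    let ?P = "(\<lambda>a. fst (E a)) ` J"
    have "E ` J \<subseteq> Sigma ?P (\<lambda>p. {..<A.capmult L (fst p) (snd p)})"
      using Id(2) J(1) by (force simp: E_def)
    then have "card (E ` J) \<le> card (Sigma ?P (\<lambda>p. {..<A.capmult L (fst p) (snd p)}))"
      using J(2) by (intro card_mono) auto
    also have "\<dots> = (\<Sum>p\<in>?P. A.capmult L (fst p) (snd p))" using J(2) by simp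
    finally show ?thesis
      using card_image[OF inj_on_subset[OF injE J(1)]] by (simp add: case_prod_beta)
  qed
  have US: "\<Union>(S ` J) = Sigma (Q ((\<lambda>a. fst (E a)) ` J)) (\<lambda>q. {..<B.capmult L (fst q) (snd q)})" for J
    unfolding S_def Q_def near_def by (auto simp: case_prod_beta)
  have hall: "finite (\<Union>(S ` J))" "card J \<le> card (\<Union>(S ` J))" if J: "J \<subseteq> I" "finite J" for J
  proof -
    let ?P = "(\<lambda>a. fst (E a)) ` J"
    have P: "finite ?P" "\<And>u v. (u, v) \<in> ?P \<Longrightarrow> 2 * \<eta> < v - u"
      using J Id(1) by (auto, metis fst_conv snd_conv subsetD)
    have Q: "finite (Q ?P)" "(\<Sum>(u, v)\<in>?P. A.capmult L u v) \<le> (\<Sum>(x, y)\<in>Q ?P. B.capmult L x y)"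
      using C.mult_hall[OF eta P] unfolding Q_def A.capmult_def B.capmult_def by auto
    show "finite (\<Union>(S ` J))" unfolding US using Q(1) by auto
    have "card (\<Union>(S ` J)) = (\<Sum>q\<in>Q ?P. B.capmult L (fst q) (snd q))"
      unfolding US using Q(1) by simp
    then show "card J \<le> card (\<Union>(S ` J))"
      using card_le[OF J] Q(2) by (simp add: case_prod_beta)
  qed
  have finI: "finite I"
  proof -
    have pos: "0 < \<eta>" using eps eta by simp
    let ?F = "{(x, y). 2 * \<eta> \<le> y - x \<and> C.A.mult x y > 0}"
    have "E ` I \<subseteq> Sigma ?F (\<lambda>p. {..<A.capmult L (fst p) (snd p)})"
      using Id(1,2) unfolding A.capmult_def by (force simp: E_def)
    moreover have "finite (Sigma ?F (\<lambda>p. {..<A.capmult L (fst p) (snd p)}))"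
      using C.A.finite_mult_far[of "2 * \<eta>"] pos by auto
    ultimately have "finite (E ` I)" by (rule finite_subset)
    then show ?thesis using injE by (rule finite_imageD)
  qed
  have "\<exists>f. inj_on f I \<and> (\<forall>a\<in>I. f a \<in> S a)"
  proof (rule hall_marriage[OF finI])
    show "finite (S a)" if "a \<in> I" for a using hall(1)[of "{a}"] that by simp
    show "card J \<le> card (\<Union>(S ` J))" if "J \<subseteq> I" for J
      using hall(2)[OF that finite_subset[OF that finI]] .
  qed
  then obtain f where f: "inj_on f I" "\<And>a. a \<in> I \<Longrightarrow> f a \<in> S a" by blast
  define g where "g a = ((fst (fst (f a)), unflat L (snd (fst (f a)))), snd (f a))" for a
  have "inj_on g I"
  proof (rule inj_onI)
    fix a b assume ab: "a \<in> I" "b \<in> I" "g a = g b"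
    then have "f a = f b" by (auto simp: g_def unflat_def prod_eq_iff split: if_splits)
    then show "a = b" using f(1) ab by (simp add: inj_on_eq_iff)
  qed
  moreover have "g a \<in> aug (diagram B.rk) \<and> ereal (fst (fst (g a))) < snd (fst (g a)) \<and>
      dstar (fst a) (fst (g a)) \<le> ereal \<eta>" if a: "a \<in> I" for a
  proof -
    obtain u w i where aw: "a = ((u, w), i)" by (metis prod.exhaust)
    obtain x y j where fa: "f a = ((x, y), j)" by (metis prod.exhaust)
    have xy: "x < y" "j < B.capmult L x y" "\<bar>x - u\<bar> \<le> \<eta>" "\<bar>y - flat L w\<bar> \<le> \<eta>"
      using f(2)[OF a] fa by (auto simp: S_def near_def E_def aw)
    note d = B.diagram_capmult[OF L(1) xy(1)]
    have lt: "ereal x < unflat L y" using xy(1) by (simp add: unflat_def)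
    have "j < diagram B.rk (x, unflat L y)" using d(1) xy(2) by simp
    then have "g a \<in> aug (diagram B.rk)" using lt by (simp add: g_def fa aug_def)
    moreover have "dstar (u, w) (x, unflat L y) \<le> ereal \<eta>"
    proof (cases "w = \<infinity>")
      case True
      then have "y = L" using d(2) xy L eps eta by (auto simp: abs_le_iff)
      then show ?thesis using True xy(3) by (simp add: dstar_def unflat_def abs_minus_commute)
    next
      case False
      then obtain v where v: "w = ereal v" "v \<le> M" using Id(3)[OF a] by (auto simp: aw)
      then have "y \<noteq> L" using xy(4) L eps eta by (auto simp: abs_le_iff)
      then show ?thesis using v xy by (simp add: dstar_def unflat_def abs_minus_commute min.coboundedI1)
    qed
    ultimately show ?thesis using lt fa by (simp add: g_def aw)
  qed
  ultimately show ?thesis by (intro exI[of _ g]) (auto simp: I_def)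
qed

end

theorem (in interleaved_bounded) stability:
  assumes "\<epsilon> < \<eta>"
  shows "dmatch (diagram A.rk) (diagram B.rk) \<le> ereal \<eta>"
proof -
  interpret S: interleaved_bounded scale Z' N' Z N M \<epsilon>
    by unfold_locales (use eps Z_shift N_shift in auto)
  obtain f where "inj_on f {a \<in> aug (diagram A.rk). far \<eta> a}"
    "\<And>a. a \<in> aug (diagram A.rk) \<Longrightarrow> far \<eta> a \<Longrightarrow> f a \<in> aug (diagram B.rk) \<and>
       ereal (fst (fst (f a))) < snd (fst (f a)) \<and> dstar (fst a) (fst (f a)) \<le> ereal \<eta>"
    using far_matching[OF assms] by blast
  moreover obtain g where "inj_on g {a \<in> aug (diagram B.rk). far \<eta> a}"
    "\<And>a. a \<in> aug (diagram B.rk) \<Longrightarrow> far \<eta> a \<Longrightarrow> g a \<in> aug (diagram A.rk) \<and>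
       ereal (fst (fst (g a))) < snd (fst (g a)) \<and> dstar (fst a) (fst (g a)) \<le> ereal \<eta>"
    using S.far_matching[OF assms] by blast
  ultimately show ?thesis by (rule dmatch_le)
qed

section \<open>Cech persistence modules\<close>

text \<open>The sums in \<open>bd\<close> and \<open>push\<close> run over the support, which
  changes when chains are added. Over a common finite set linearity is checked term by term.\<close>

lemma bd_superset:
  assumes "finite S" "{s. c s \<noteq> 0} \<subseteq> S"
  shows "bd c t = (\<Sum>s\<in>S. \<Sum>i<length s. if take i s @ drop (Suc i) s = t then (-1) ^ i * c s else 0)"
  unfolding bd_def by (rule sum.mono_neutral_left) (use assms in \<open>auto intro!: sum.neutral cong: if_cong\<close>)

lemma push_superset:
  assumes "finite S" "{s. c s \<noteq> 0} \<subseteq> S"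
  shows "push lam c t = (\<Sum>s\<in>S. if map lam s = t then c s else 0)"
  unfolding push_def by (rule sum.mono_neutral_left) (use assms in auto)

lemma
  assumes "finite {s. c s \<noteq> 0}" "finite {s. d s \<noteq> 0}"
  shows bd_add: "bd (\<lambda>s. c s + d s) = (\<lambda>t. bd c t + bd d t)"
    and push_add: "push lam (\<lambda>s. c s + d s) = (\<lambda>t. push lam c t + push lam d t)"
proof -
  let ?S = "{s. c s \<noteq> 0} \<union> {s. d s \<noteq> 0}"
  have S: "finite ?S" "{s. c s \<noteq> 0} \<subseteq> ?S" "{s. d s \<noteq> 0} \<subseteq> ?S" "{s. c s + d s \<noteq> 0} \<subseteq> ?S"
    using assms by auto
  show "bd (\<lambda>s. c s + d s) = (\<lambda>t. bd c t + bd d t)"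
    unfolding bd_superset[OF S(1,2)] bd_superset[OF S(1,3)] bd_superset[OF S(1,4)]
    by (intro ext, unfold sum.distrib[symmetric], intro sum.cong refl) (auto simp: distrib_left)
  show "push lam (\<lambda>s. c s + d s) = (\<lambda>t. push lam c t + push lam d t)"
    unfolding push_superset[OF S(1,2)] push_superset[OF S(1,3)] push_superset[OF S(1,4)]
    by (intro ext, unfold sum.distrib[symmetric], intro sum.cong refl) auto
qed

lemma
  assumes "finite {s. c s \<noteq> 0}"
  shows bd_scale: "bd (\<lambda>s. a * c s) = (\<lambda>t. a * bd c t)"
    and push_scale: "push lam (\<lambda>s. a * c s) = (\<lambda>t. a * push lam c t)"
proof -
  have S: "{s. a * c s \<noteq> 0} \<subseteq> {s. c s \<noteq> 0}" by auto
  show "bd (\<lambda>s. a * c s) = (\<lambda>t. a * bd c t)"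
    unfolding bd_superset[OF assms S] bd_superset[OF assms subset_refl]
    by (simp add: sum_distrib_left if_distrib mult.left_commute cong: if_cong)
  show "push lam (\<lambda>s. a * c s) = (\<lambda>t. a * push lam c t)"
    unfolding push_superset[OF assms S] push_superset[OF assms subset_refl]
    by (simp add: sum_distrib_left if_distrib cong: if_cong)
qed

lemma bd_zero [simp]: "bd (\<lambda>_. 0) = (\<lambda>_. 0)"
  and push_zero [simp]: "push lam (\<lambda>_. 0) = (\<lambda>_. 0)"
  by (auto simp: bd_def push_def fun_eq_iff)

lemma is_chain_zero [simp]: "is_chain Y U k (\<lambda>_. 0)"
  by (simp add: is_chain_def)

lemma is_chain_finite: "is_chain Y U k c \<Longrightarrow> finite {s. c s \<noteq> 0}"
  by (simp add: is_chain_def)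

lemma is_chain_add: "is_chain Y U k c \<Longrightarrow> is_chain Y U k d \<Longrightarrow> is_chain Y U k (\<lambda>s. c s + d s)"
  unfolding is_chain_def
  by (rule conjI, rule finite_subset[of _ "{s. c s \<noteq> 0} \<union> {s. d s \<noteq> 0}"]) (auto, metis add_0)

lemma is_chain_scale: "is_chain Y U k c \<Longrightarrow> is_chain Y U k (\<lambda>s. a * c s)"
  unfolding is_chain_def by (rule conjI, rule finite_subset[of _ "{s. c s \<noteq> 0}"]) auto

lemma is_chain_mono: "is_chain Y U k c \<Longrightarrow> Y \<subseteq> Y' \<Longrightarrow> is_chain Y' U k c"
  unfolding is_chain_def nerve_simplex_def by blast

lemma is_cycle_zero: "is_cycle Y U k (\<lambda>_. 0)"
  by (simp add: is_cycle_def)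

lemma is_cycle_add: "is_cycle Y U k c \<Longrightarrow> is_cycle Y U k d \<Longrightarrow> is_cycle Y U k (\<lambda>s. c s + d s)"
  by (auto simp: is_cycle_def is_chain_add bd_add is_chain_finite)

lemma is_cycle_scale: "is_cycle Y U k c \<Longrightarrow> is_cycle Y U k (\<lambda>s. a * c s)"
  by (auto simp: is_cycle_def is_chain_scale bd_scale is_chain_finite)

lemma is_cycle_mono: "is_cycle Y U k c \<Longrightarrow> Y \<subseteq> Y' \<Longrightarrow> is_cycle Y' U k c"
  by (auto simp: is_cycle_def is_chain_mono)

lemma homologous_refl: "homologous Y U k c c"
  unfolding homologous_def by (intro exI[of _ "\<lambda>_. 0"]) simp

lemma homologous_add:
  assumes "homologous Y U k c c'" "homologous Y U k d d'"
  shows "homologous Y U k (\<lambda>s. c s + d s) (\<lambda>s. c' s + d' s)"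
proof -
  obtain p q where p: "is_chain Y U (Suc k) p" "(\<lambda>s. c s - c' s) = bd p"
    and q: "is_chain Y U (Suc k) q" "(\<lambda>s. d s - d' s) = bd q"
    using assms by (auto simp: homologous_def)
  have "bd (\<lambda>s. p s + q s) = (\<lambda>t. bd p t + bd q t)"
    by (rule bd_add) (use p q in \<open>auto simp: is_chain_def\<close>)
  also have "\<dots> = (\<lambda>s. (c s + d s) - (c' s + d' s))"
    unfolding p(2)[symmetric] q(2)[symmetric] by (simp add: algebra_simps)
  finally show ?thesis
    unfolding homologous_def using is_chain_add[OF p(1) q(1)] by metis
qed

lemma homologous_scale:
  assumes "homologous Y U k c c'"
  shows "homologous Y U k (\<lambda>s. a * c s) (\<lambda>s. a * c' s)"
proof -
  obtain p where p: "is_chain Y U (Suc k) p" "(\<lambda>s. c s - c' s) = bd p"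
    using assms by (auto simp: homologous_def)
  have "bd (\<lambda>s. a * p s) = (\<lambda>t. a * bd p t)"
    by (rule bd_scale) (use p in \<open>auto simp: is_chain_def\<close>)
  also have "\<dots> = (\<lambda>s. a * c s - a * c' s)"
    unfolding p(2)[symmetric] by (simp add: algebra_simps)
  finally show ?thesis
    unfolding homologous_def using is_chain_scale[OF p(1)] by metis
qed

lemma homologous_mono: "homologous Y U k c c' \<Longrightarrow> Y \<subseteq> Y' \<Longrightarrow> homologous Y' U k c c'"
  unfolding homologous_def using is_chain_mono by blast

lemma open_cover_mono: "open_cover Phi Y' U \<Longrightarrow> Y \<subseteq> Y' \<Longrightarrow> open_cover Phi Y U"
  by (auto simp: open_cover_def)

section \<open>Cech families as one vector space with two filtrations\<close>

definition fscale :: "'k::field \<Rightarrow> ('x set set \<Rightarrow> 'x set list \<Rightarrow> 'k) \<Rightarrow> 'x set set \<Rightarrow> 'x set list \<Rightarrow> 'k"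
  where "fscale a h = (\<lambda>U s. a * h U s)"

interpretation fam: vector_space fscale
  by unfold_locales (auto simp: fscale_def fun_eq_iff algebra_simps)

text \<open>A member is arbitrary at collections that do not cover \<open>Y\<close>. This freedom is
  harmless, because \<open>cech_null\<close> ignores such collections as well.\<close>

definition cech_cycles :: "('x \<Rightarrow> real) set \<Rightarrow> nat \<Rightarrow> 'x set \<Rightarrow> ('x set set \<Rightarrow> 'x set list \<Rightarrow> 'k::field) set"
  where "cech_cycles Phi k Y = {h. cech_elem Phi Y k h}"

definition cech_null :: "('x \<Rightarrow> real) set \<Rightarrow> nat \<Rightarrow> 'x set \<Rightarrow> ('x set set \<Rightarrow> 'x set list \<Rightarrow> 'k::field) set"
  where "cech_null Phi k Y = {h. \<forall>U. open_cover Phi Y U \<longrightarrow> homologous Y U k (h U) (\<lambda>_. 0)}"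

text \<open>A compatible family for Y is, verbatim, one for every larger Y', because covers of Y' are
  covers of Y. Hence the persistence module is a quotient of two increasing families of subspaces
  of one fixed vector space.\<close>

lemma cech_cycles_mono: "Y \<subseteq> Y' \<Longrightarrow> cech_cycles Phi k Y \<subseteq> cech_cycles Phi k Y'"
  unfolding cech_cycles_def cech_elem_def Collect_mono_iff
  by (meson is_cycle_mono homologous_mono open_cover_mono)

lemma cech_null_mono: "Y \<subseteq> Y' \<Longrightarrow> cech_null Phi k Y \<subseteq> cech_null Phi k Y'"
  unfolding cech_null_def Collect_mono_iff by (meson homologous_mono open_cover_mono)

lemma plus_fun2: "(h + h') U = (\<lambda>s. h U s + h' U s)"
  and zero_fun2: "(0 :: 'a \<Rightarrow> 'b \<Rightarrow> 'c::monoid_add) U = (\<lambda>_. 0)"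
  by (auto simp: fun_eq_iff)

lemma sum_fun2: "(\<Sum>i\<in>I. f i) U s = (\<Sum>i\<in>I. f i U s)"
  by (induction I rule: infinite_finite_induct) auto

lemma subspace_cech_cycles:
  fixes Phi :: "('x \<Rightarrow> real) set"
  shows "fam.subspace (cech_cycles Phi k Y :: ('x set set \<Rightarrow> 'x set list \<Rightarrow> 'k::field) set)"
proof (rule fam.subspaceI)
  show "0 \<in> cech_cycles Phi k Y"
    unfolding cech_cycles_def cech_elem_def zero_fun2
    by (auto simp: is_cycle_zero homologous_refl)
  fix h h' :: "'x set set \<Rightarrow> 'x set list \<Rightarrow> 'k"
  assume h: "h \<in> cech_cycles Phi k Y"
  have fin: "finite {s. h V s \<noteq> 0}" if "open_cover Phi Y V" for V
    using h that by (auto simp: cech_cycles_def cech_elem_def is_cycle_def is_chain_def)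
  show "fscale a h \<in> cech_cycles Phi k Y" for a
    using h fin unfolding cech_cycles_def cech_elem_def fscale_def
    by (auto simp: is_cycle_scale push_scale homologous_scale)
  assume h': "h' \<in> cech_cycles Phi k Y"
  have fin': "finite {s. h' V s \<noteq> 0}" if "open_cover Phi Y V" for V
    using h' that by (auto simp: cech_cycles_def cech_elem_def is_cycle_def is_chain_def)
  show "h + h' \<in> cech_cycles Phi k Y"
    using h h' fin fin' unfolding cech_cycles_def cech_elem_def plus_fun2
    by (auto simp: is_cycle_add push_add homologous_add)
qed

lemma subspace_cech_null:
  fixes Phi :: "('x \<Rightarrow> real) set"
  shows "fam.subspace (cech_null Phi k Y :: ('x set set \<Rightarrow> 'x set list \<Rightarrow> 'k::field) set)"
proof (rule fam.subspaceI)
  show "0 \<in> cech_null Phi k Y"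
    unfolding cech_null_def zero_fun2 by (auto simp: homologous_refl)
  show "fscale a h \<in> cech_null Phi k Y" if "h \<in> cech_null Phi k Y" for a and h :: "'x set set \<Rightarrow> 'x set list \<Rightarrow> 'k"
    using that homologous_scale[of Y _ k "h _" "\<lambda>_. 0" a] unfolding cech_null_def fscale_def by auto
  show "h + h' \<in> cech_null Phi k Y" if "h \<in> cech_null Phi k Y" "h' \<in> cech_null Phi k Y"
    for h h' :: "'x set set \<Rightarrow> 'x set list \<Rightarrow> 'k"
    using that homologous_add[of Y _ k "h _" "\<lambda>_. 0" "h' _" "\<lambda>_. 0"]
    unfolding cech_null_def plus_fun2 by auto
qed

lemma cech_image_rank_eq:
  "cech_image_rank (TK :: 'k::field itself) Phi k Y Y' =
     fam.quot_rank (cech_cycles Phi k Y :: ('x set set \<Rightarrow> 'x set list \<Rightarrow> 'k) set) (cech_null Phi k Y')"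
proof -
  have "(\<lambda>s. \<Sum>i<n. c i * hs i U s) = (\<Sum>i<n. fscale (c i) (hs i)) U"
    for n c U and hs :: "nat \<Rightarrow> 'x set set \<Rightarrow> 'x set list \<Rightarrow> 'k"
    by (rule ext) (simp add: sum_fun2 fscale_def)
  then show ?thesis
    unfolding cech_image_rank_def fam.quot_rank_def cech_cycles_def cech_null_def by simp
qed

text \<open>The nerve over the empty set has no simplices, so all its chains vanish. This yields
  \<open>rk_neg\<close>, as negative sublevel sets of a non-negative function are empty.\<close>

lemma cech_cycles_empty: "cech_cycles Phi k {} \<subseteq> cech_null Phi k Y"
proof
  fix h assume h: "h \<in> cech_cycles Phi k {}"
  have "h U = (\<lambda>_. 0)" if "open_cover Phi Y U" for U
    using h open_cover_mono[OF that, of "{}"]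
    by (auto simp: cech_cycles_def cech_elem_def is_cycle_def is_chain_def nerve_simplex_def fun_eq_iff)
  then show "h \<in> cech_null Phi k Y" by (simp add: cech_null_def homologous_refl)
qed

lemma cech_image_rank_empty: "cech_image_rank TK Phi k {} Y = 0"
  unfolding cech_image_rank_eq by (rule fam.quot_rank_eq_0[OF cech_cycles_empty subspace_cech_null])

lemma cech_filtration:
  fixes TK :: "'k::field itself" and psi :: "'x \<Rightarrow> real"
  assumes tame: "\<And>u v. u < v \<Longrightarrow> cech_image_rank TK Phi k {x. psi x \<le> u} {x. psi x \<le> v} \<noteq> \<infinity>"
    and bounds: "\<And>x. 0 \<le> psi x" "\<And>x. psi x \<le> M" and M: "0 \<le> M"
  shows "bounded_filtration fscale (\<lambda>t. cech_cycles Phi k {x. psi x \<le> t} :: ('x set set \<Rightarrow> 'x set list \<Rightarrow> 'k) set)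
      (\<lambda>t. cech_null Phi k {x. psi x \<le> t}) M"
    and "tame_filtration.rk fscale (\<lambda>t. cech_cycles Phi k {x. psi x \<le> t} :: ('x set set \<Rightarrow> 'x set list \<Rightarrow> 'k) set)
      (\<lambda>t. cech_null Phi k {x. psi x \<le> t}) = pers_rank TK Phi k psi"
proof -
  interpret T: tame_filtration fscale "\<lambda>t. cech_cycles Phi k {x. psi x \<le> t} :: ('x set set \<Rightarrow> 'x set list \<Rightarrow> 'k) set"
    "\<lambda>t. cech_null Phi k {x. psi x \<le> t}"
  proof
    show "fam.quot_rank (cech_cycles Phi k {x. psi x \<le> u} :: ('x set set \<Rightarrow> 'x set list \<Rightarrow> 'k) set)
      (cech_null Phi k {x. psi x \<le> v}) \<noteq> \<infinity>" if "u < v" for u v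
      using tame[OF that] unfolding cech_image_rank_eq .
    show "cech_cycles Phi k {x. psi x \<le> s} \<subseteq> (cech_cycles Phi k {x. psi x \<le> t} :: ('x set set \<Rightarrow> 'x set list \<Rightarrow> 'k) set)"
      "cech_null Phi k {x. psi x \<le> s} \<subseteq> (cech_null Phi k {x. psi x \<le> t} :: ('x set set \<Rightarrow> 'x set list \<Rightarrow> 'k) set)"
      if "s \<le> t" for s t
      using that by (intro cech_cycles_mono cech_null_mono Collect_mono; auto)+
  qed (rule subspace_cech_cycles subspace_cech_null)+
  show rk: "T.rk = pers_rank TK Phi k psi"
    by (intro ext) (simp add: T.rk_def pers_rank_def cech_image_rank_eq)
  have top: "{x. psi x \<le> t} = {x. psi x \<le> M}" if "M \<le> t" for t
    using bounds that by (auto intro: order_trans)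
  have bot: "{x. psi x \<le> t} = {}" if "t < 0" for t
    using bounds(1) that by (auto simp: not_le intro: less_le_trans)
  show "bounded_filtration fscale (\<lambda>t. cech_cycles Phi k {x. psi x \<le> t} :: ('x set set \<Rightarrow> 'x set list \<Rightarrow> 'k) set)
      (\<lambda>t. cech_null Phi k {x. psi x \<le> t}) M"
  proof
    show "T.rk u v = 0" if "u < 0" "u < v" for u v
      unfolding rk pers_rank_def bot[OF that(1)] cech_image_rank_empty by (simp add: zero_enat_def)
    show "cech_cycles Phi k {x. psi x \<le> t} = (cech_cycles Phi k {x. psi x \<le> M} :: ('x set set \<Rightarrow> 'x set list \<Rightarrow> 'k) set)"
      "cech_null Phi k {x. psi x \<le> t} = (cech_null Phi k {x. psi x \<le> M} :: ('x set set \<Rightarrow> 'x set list \<Rightarrow> 'k) set)"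
      if "M \<le> t" for t
      by (simp_all only: top[OF that])
  qed (rule M)
qed

lemma pers_rank_stability:
  fixes TK :: "'k::field itself" and psi1 psi2 :: "'x \<Rightarrow> real"
  assumes tame: "\<And>u v. u < v \<Longrightarrow> cech_image_rank TK Phi k {x. psi1 x \<le> u} {x. psi1 x \<le> v} \<noteq> \<infinity>"
      "\<And>u v. u < v \<Longrightarrow> cech_image_rank TK Phi k {x. psi2 x \<le> u} {x. psi2 x \<le> v} \<noteq> \<infinity>"
    and nonneg: "\<And>x. 0 \<le> psi1 x" "\<And>x. 0 \<le> psi2 x"
    and bdd: "bounded (range psi1)" "bounded (range psi2)"
    and close: "\<And>x. \<bar>psi1 x - psi2 x\<bar> \<le> \<epsilon>" and "\<epsilon> < \<eta>"
  shows "dmatch (diagram (pers_rank TK Phi k psi1)) (diagram (pers_rank TK Phi k psi2)) \<le> ereal \<eta>"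
proof -
  obtain M1 M2 where "\<And>x. \<bar>psi1 x\<bar> \<le> M1" "\<And>x. \<bar>psi2 x\<bar> \<le> M2"
    using bdd unfolding bounded_iff by auto
  then have M: "psi1 x \<le> max 0 (max M1 M2)" "psi2 x \<le> max 0 (max M1 M2)" for x
    by (meson abs_le_D1 max.coboundedI1 max.coboundedI2)+
  have e: "0 \<le> \<epsilon>" using close[of undefined] by linarith
  note f1 = cech_filtration[OF tame(1) nonneg(1) M(1) max.cobounded1]
    and f2 = cech_filtration[OF tame(2) nonneg(2) M(2) max.cobounded1]
  have s: "{x. psi1 x \<le> t} \<subseteq> {x. psi2 x \<le> t + \<epsilon>}" "{x. psi2 x \<le> t} \<subseteq> {x. psi1 x \<le> t + \<epsilon>}" for t
    using close by (auto simp: abs_le_iff) (smt (verit))+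
  have "interleaved_bounded fscale
    (\<lambda>t. cech_cycles Phi k {x. psi1 x \<le> t} :: ('x set set \<Rightarrow> 'x set list \<Rightarrow> 'k) set)
    (\<lambda>t. cech_null Phi k {x. psi1 x \<le> t}) (\<lambda>t. cech_cycles Phi k {x. psi2 x \<le> t})
    (\<lambda>t. cech_null Phi k {x. psi2 x \<le> t}) (max 0 (max M1 M2)) \<epsilon>"
    by (intro interleaved_bounded.intro interleaved_bounded_axioms.intro f1(1) f2(1) e
        cech_cycles_mono cech_null_mono s)
  from interleaved_bounded.stability[OF this \<open>\<epsilon> < \<eta>\<close>] show ?thesis
    by (simp only: f1(2) f2(2))
qed

section \<open>Invariance under homeomorphisms\<close>

text \<open>Records what homology sees of a homeomorphism: it permutes points and open sets, hence
  covers and their nerves.\<close>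

locale relabelling =
  fixes Phi :: "('x \<Rightarrow> real) set" and g :: "'x \<Rightarrow> 'x"
  assumes bij: "bij g" and DXopen_image: "DXopen Phi (g ` S) \<longleftrightarrow> DXopen Phi S"
begin

definition im :: "'x set \<Rightarrow> 'x set" where "im A = g ` A"
definition pre :: "'x set \<Rightarrow> 'x set" where "pre A = g -` A"

lemma im_pre [simp]: "im (pre A) = A" and pre_im [simp]: "pre (im A) = A"
  using bij by (auto simp: im_def pre_def bij_def inj_vimage_image_eq surj_image_vimage_eq)

lemma map_im_pre: "map im (map pre s) = s" "map pre (map im s) = s"
  by (simp_all add: o_def)

lemma pre_eq_iff [simp]: "pre A = pre B \<longleftrightarrow> A = B"
  by (metis im_pre)

lemma image_im_pre [simp]: "im ` pre ` U = U" "pre ` im ` U = U"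
  by (simp_all add: image_image)

lemma map_pre_eq_iff [simp]: "map pre s = map pre t \<longleftrightarrow> s = t"
  by (metis map_im_pre(1))

definition relabel :: "('x set list \<Rightarrow> 'k::field) \<Rightarrow> 'x set list \<Rightarrow> 'k" where
  "relabel c = (\<lambda>s. c (map pre s))"

lemma bij_map_pre: "bij_betw (map pre) {s. c (map pre s) \<noteq> 0} {s. c s \<noteq> 0}"
  by (rule bij_betw_byWitness[where f' = "map im"]) (auto simp: map_im_pre simp del: map_map)

lemma open_cover_image: "open_cover Phi (g ` Y) U \<longleftrightarrow> open_cover Phi Y (pre ` U)"
proof -
  have "DXopen Phi (pre A) \<longleftrightarrow> DXopen Phi A" for A
    using DXopen_image[of "pre A"] im_pre[of A] by (simp add: im_def)
  then show ?thesis unfolding open_cover_def by (auto simp: pre_def) blast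
qed

lemma nerve_simplex_image: "nerve_simplex (g ` Y) U k s \<longleftrightarrow> nerve_simplex Y (pre ` U) k (map pre s)"
proof -
  have "set s \<subseteq> U \<longleftrightarrow> pre ` set s \<subseteq> pre ` U" by (auto simp: subset_iff image_iff)
  moreover have "g ` Y \<inter> \<Inter>(set s) \<noteq> {} \<longleftrightarrow> Y \<inter> \<Inter>(pre ` set s) \<noteq> {}" by (auto simp: pre_def)
  ultimately show ?thesis by (simp add: nerve_simplex_def)
qed

lemma is_chain_relabel: "is_chain (g ` Y) U k (relabel c) \<longleftrightarrow> is_chain Y (pre ` U) k c"
proof -
  have "(\<forall>s. c (map pre s) \<noteq> 0 \<longrightarrow> nerve_simplex Y (pre ` U) k (map pre s)) \<longleftrightarrow>
    (\<forall>s. c s \<noteq> 0 \<longrightarrow> nerve_simplex Y (pre ` U) k s)"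
    by (metis map_im_pre(2))
  then show ?thesis
    unfolding is_chain_def relabel_def nerve_simplex_image using bij_betw_finite[OF bij_map_pre[of c]] by simp
qed

lemma bd_relabel: "bd (relabel c) = relabel (bd c)"
proof
  fix t
  have "relabel (bd c) t = (\<Sum>s\<in>{s. c (map pre s) \<noteq> 0}. \<Sum>i<length (map pre s).
      if take i (map pre s) @ drop (Suc i) (map pre s) = map pre t then (-1) ^ i * c (map pre s) else 0)"
    unfolding bd_def relabel_def by (rule sum.reindex_bij_betw[OF bij_map_pre, symmetric])
  also have "\<dots> = bd (relabel c) t"
    unfolding bd_def relabel_def take_map drop_map map_append[symmetric] map_pre_eq_iff length_map ..
  finally show "bd (relabel c) t = relabel (bd c) t" ..
qed

lemma push_relabel: "push lam (relabel c) = relabel (push (pre \<circ> lam \<circ> im) c)"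
proof
  fix t
  have "relabel (push (pre \<circ> lam \<circ> im) c) t = (\<Sum>s\<in>{s. c (map pre s) \<noteq> 0}.
      if map (pre \<circ> lam \<circ> im) (map pre s) = map pre t then c (map pre s) else 0)"
    unfolding push_def relabel_def by (rule sum.reindex_bij_betw[OF bij_map_pre, symmetric])
  moreover have "map (pre \<circ> lam \<circ> im) (map pre s) = map pre (map lam s)" for s
    by (simp add: o_def)
  ultimately show "push lam (relabel c) t = relabel (push (pre \<circ> lam \<circ> im) c) t"
    by (simp only: push_def relabel_def map_pre_eq_iff)
qed

lemma relabel_surj: "\<exists>c. d = relabel c"
  by (rule exI[of _ "\<lambda>s. d (map im s)"]) (simp only: relabel_def map_im_pre)

lemma relabel_eq_iff: "relabel c = relabel d \<longleftrightarrow> c = d"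
  unfolding relabel_def fun_eq_iff by (metis map_im_pre(2))

lemma relabel_zero: "relabel (\<lambda>_. 0) = (\<lambda>_. 0)"
  by (simp add: relabel_def)

lemma is_cycle_relabel: "is_cycle (g ` Y) U k (relabel c) \<longleftrightarrow> is_cycle Y (pre ` U) k c"
  using relabel_eq_iff[of "bd c" "\<lambda>_. 0"]
  by (simp add: is_cycle_def is_chain_relabel bd_relabel relabel_zero)

lemma homologous_relabel:
  "homologous (g ` Y) U k (relabel c) (relabel c') \<longleftrightarrow> homologous Y (pre ` U) k c c'"
proof -
  have e: "(\<lambda>s. relabel c s - relabel c' s) = relabel (\<lambda>s. c s - c' s)" by (simp add: relabel_def)
  have "homologous (g ` Y) U k (relabel c) (relabel c') \<longleftrightarrow>
    (\<exists>d. is_chain (g ` Y) U (Suc k) (relabel d) \<and> relabel (\<lambda>s. c s - c' s) = bd (relabel d))"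
    unfolding homologous_def e
  proof (intro iffI; elim exE)
    fix d assume "is_chain (g ` Y) U (Suc k) d \<and> relabel (\<lambda>s. c s - c' s) = bd d"
    moreover obtain d' where "d = relabel d'" using relabel_surj by blast
    ultimately show "\<exists>d. is_chain (g ` Y) U (Suc k) (relabel d) \<and> relabel (\<lambda>s. c s - c' s) = bd (relabel d)"
      by auto
  qed blast
  then show ?thesis
    unfolding is_chain_relabel bd_relabel relabel_eq_iff homologous_def .
qed

lemma refinement_map_relabel:
  "refinement_map V U lam \<Longrightarrow> refinement_map (pre ` V) (pre ` U) (pre \<circ> lam \<circ> im)"
  by (auto simp: refinement_map_def pre_def[symmetric] dest: vimage_mono[of _ "lam _" g, folded pre_def])

definition transport :: "('x set set \<Rightarrow> 'x set list \<Rightarrow> 'k::field) \<Rightarrow> 'x set set \<Rightarrow> 'x set list \<Rightarrow> 'k" where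
  "transport h U = relabel (h (pre ` U))"

lemma transport_cycles: "h \<in> cech_cycles Phi k Y \<Longrightarrow> transport h \<in> cech_cycles Phi k (g ` Y)"
  unfolding cech_cycles_def cech_elem_def transport_def
  by (auto simp: is_cycle_relabel push_relabel homologous_relabel open_cover_image refinement_map_relabel)

text \<open>Reflecting nullity is what keeps the images of independent families independent. Every
  cover of \<open>Y\<close> is the pullback of its own image under \<open>im\<close>.\<close>

lemma transport_null:
  assumes "transport h \<in> cech_null Phi k (g ` Y)"
  shows "h \<in> cech_null Phi k Y"
  unfolding cech_null_def
proof (intro CollectI allI impI)
  fix U assume U: "open_cover Phi Y U"
  then have "open_cover Phi (g ` Y) (im ` U)" by (simp add: open_cover_image)
  then have "homologous (g ` Y) (im ` U) k (relabel (h U)) (relabel (\<lambda>_. 0))"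
    using assms unfolding cech_null_def transport_def relabel_zero by force
  then show "homologous Y U k (h U) (\<lambda>_. 0)" unfolding homologous_relabel by simp
qed

text \<open>The reverse inequality is the same statement for the inverse of
  \<open>g\<close>.\<close>

lemma cech_image_rank_image_le:
  "cech_image_rank (TK :: 'k::field itself) Phi k Y Y' \<le> cech_image_rank TK Phi k (g ` Y) (g ` Y')"
proof -
  have lin: "transport (\<Sum>i<n. fscale (c i) (hs i)) = (\<Sum>i<n. fscale (c i) (transport (hs i)))"
    for n c and hs :: "nat \<Rightarrow> 'x set set \<Rightarrow> 'x set list \<Rightarrow> 'k"
    by (intro ext) (simp add: transport_def relabel_def sum_fun2 fscale_def)
  show ?thesis
    unfolding cech_image_rank_eq fam.quot_rank_def
  proof (rule Sup_subset_mono, clarify)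
    fix n and hs :: "nat \<Rightarrow> 'x set set \<Rightarrow> 'x set list \<Rightarrow> 'k"
    assume hs: "\<forall>i<n. hs i \<in> cech_cycles Phi k Y"
      and ind: "\<forall>c. (\<Sum>i<n. fscale (c i) (hs i)) \<in> cech_null Phi k Y' \<longrightarrow> (\<forall>i<n. c i = 0)"
    have "\<forall>i<n. transport (hs i) \<in> cech_cycles Phi k (g ` Y)" using hs transport_cycles by blast
    moreover have "\<forall>c. (\<Sum>i<n. fscale (c i) (transport (hs i))) \<in> cech_null Phi k (g ` Y') \<longrightarrow> (\<forall>i<n. c i = 0)"
      unfolding lin[symmetric] using ind transport_null by blast
    ultimately show "\<exists>n'. enat n = enat n' \<and> (\<exists>hs. (\<forall>i<n'. hs i \<in> cech_cycles Phi k (g ` Y)) \<and>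
       (\<forall>c. (\<Sum>i<n'. fscale (c i) (hs i)) \<in> (cech_null Phi k (g ` Y') :: ('x set set \<Rightarrow> 'x set list \<Rightarrow> 'k) set)
          \<longrightarrow> (\<forall>i<n'. c i = 0)))"
      by (intro exI[of _ n] exI[of _ "\<lambda>i. transport (hs i)"] conjI refl)
  qed
qed

end

lemma DXopen_homeo:
  assumes "Homeo_Phi Phi g" "DXopen Phi S"
  shows "DXopen Phi (g ` S)"
  unfolding DXopen_def
proof
  fix x assume "x \<in> g ` S"
  have b: "bij g" and c: "DX_continuous Phi (inv g)" using assms by (auto simp: Homeo_Phi_def)
  have "inv g x \<in> S" using \<open>x \<in> g ` S\<close> b by (auto simp: bij_is_inj)
  then obtain e where e: "e > 0" "\<And>y. DX Phi (inv g x) y < e \<Longrightarrow> y \<in> S"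
    using assms(2) unfolding DXopen_def by blast
  obtain d where d: "d > 0" "\<And>y. DX Phi x y < d \<Longrightarrow> DX Phi (inv g x) (inv g y) < e"
    using c e(1) unfolding DX_continuous_def by blast
  have "y \<in> g ` S" if "DX Phi x y < d" for y
    using e(2)[OF d(2)[OF that]] b by (metis bij_inv_eq_iff image_eqI)
  then show "\<exists>e>0. \<forall>y. DX Phi x y < e \<longrightarrow> y \<in> g ` S" using d(1) by blast
qed

lemma Homeo_Phi_inv:
  assumes "Homeo_Phi Phi g"
  shows "Homeo_Phi Phi (inv g)"
  using assms by (auto simp: Homeo_Phi_def bij_imp_bij_inv inv_inv_eq)

lemma relabelling_homeo:
  assumes "Homeo_Phi Phi g"
  shows "relabelling Phi g"
proof
  show b: "bij g" using assms by (simp add: Homeo_Phi_def)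
  have "inv g ` g ` S = S" for S using b by (simp add: bij_is_inj image_inv_f_f)
  then show "DXopen Phi (g ` S) \<longleftrightarrow> DXopen Phi S" for S
    using DXopen_homeo[OF assms, of S] DXopen_homeo[OF Homeo_Phi_inv[OF assms], of "g ` S"] by auto
qed

lemma pers_rank_homeo:
  assumes "Homeo_Phi Phi g"
  shows "pers_rank TK Phi k (psi \<circ> g) = pers_rank TK Phi k psi"
proof (intro ext)
  fix u v
  have b: "bij g" using assms by (simp add: Homeo_Phi_def)
  have im: "g ` {x. (psi \<circ> g) x \<le> t} = {x. psi x \<le> t}" for t
    using b by (auto simp: image_iff) (metis bij_inv_eq_iff)
  have im': "inv g ` {x. psi x \<le> t} = {x. (psi \<circ> g) x \<le> t}" for t
    unfolding im[symmetric] using b by (simp add: bij_is_inj image_inv_f_f)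
  have "cech_image_rank TK Phi k {x. (psi \<circ> g) x \<le> u} {x. (psi \<circ> g) x \<le> v} =
    cech_image_rank TK Phi k {x. psi x \<le> u} {x. psi x \<le> v}"
    using relabelling.cech_image_rank_image_le[OF relabelling_homeo[OF assms],
        of TK k "{x. (psi \<circ> g) x \<le> u}" "{x. (psi \<circ> g) x \<le> v}"]
      relabelling.cech_image_rank_image_le[OF relabelling_homeo[OF Homeo_Phi_inv[OF assms]],
        of TK k "{x. psi x \<le> u}" "{x. psi x \<le> v}"]
    unfolding im im' by (rule antisym)
  then show "pers_rank TK Phi k (psi \<circ> g) u v = pers_rank TK Phi k psi u v"
    by (simp add: pers_rank_def)
qed

section \<open>The natural pseudo-distance\<close>

lemma DPhi_bdd_above:
  fixes f h :: "'x \<Rightarrow> real"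
  assumes "bounded (range f)" "bounded (range h)"
  shows "bdd_above (range (\<lambda>x. \<bar>f x - h x\<bar>))"
proof -
  obtain a b where "\<forall>x. \<bar>f x\<bar> \<le> a" "\<forall>x. \<bar>h x\<bar> \<le> b"
    using assms unfolding bounded_iff by auto
  then have "\<bar>f x - h x\<bar> \<le> a + b" for x by (meson abs_triangle_ineq4 add_mono order_trans)
  then show ?thesis by (intro bdd_aboveI[of _ "a + b"]) auto
qed

lemma DPhi_upper:
  assumes "bounded (range f)" "bounded (range h)"
  shows "\<bar>f x - h x\<bar> \<le> DPhi f h"
  unfolding DPhi_def by (rule cSUP_upper[OF UNIV_I DPhi_bdd_above[OF assms]])

lemma DPhi_least: "(\<And>x. \<bar>f x - h x\<bar> \<le> c) \<Longrightarrow> DPhi f h \<le> c"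
  unfolding DPhi_def by (rule cSUP_least) auto

lemma DPhi_comp: "surj g \<Longrightarrow> DPhi (f \<circ> g) (h \<circ> g) = DPhi f h"
  unfolding DPhi_def using image_image[of "\<lambda>x. \<bar>f x - h x\<bar>" g UNIV] by simp

section \<open>Persistence diagrams of constant functions\<close>

lemma mult_inf_const:
  fixes b :: nat
  assumes r: "\<And>u v. u < v \<Longrightarrow> r u v = (if u < c then 0 else b)"
  shows "mult_inf r c = b" "u \<noteq> c \<Longrightarrow> mult_inf r u = 0"
proof -
  let ?S = "\<lambda>u. {int (r (u + e) v) - int (r (u - e) v) | e v. 0 < e \<and> u + e < v}"
  have "x = int b" if "x \<in> ?S c" for x using that r by auto
  moreover have "int b \<in> ?S c"
    using r by (intro CollectI exI[of _ 1] exI[of _ "c + 2"]) auto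
  ultimately have "?S c = {int b}" by blast
  then show "mult_inf r c = b" by (simp add: mult_inf_def)
  assume u: "u \<noteq> c"
  have "Inf (?S u) = 0"
  proof (rule cInf_eq_minimum)
    \<comment> \<open>With radius half of \<open>\<bar>u - c\<bar>\<close> both times lie on the
      same side of \<open>c\<close>, where the rank does not change.\<close>
    show "0 \<in> ?S u"
      using u r by (intro CollectI exI[of _ "\<bar>u - c\<bar> / 2"] exI[of _ "u + \<bar>u - c\<bar>"]) (auto simp: field_simps abs_if)
    show "0 \<le> x" if "x \<in> ?S u" for x using that r by auto
  qed
  then show "mult_inf r u = 0" by (simp add: mult_inf_def)
qed

text \<open>A bijection sends \<open>(c, \<infinity>)\<close> to a point at infinity or pays an
  infinite cost, and the second diagram has no point at infinity with birth other than
  \<open>d\<close>.\<close>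

lemma dmatch_const:
  fixes b :: nat
  assumes "0 < b" and r1: "\<And>u v. u < v \<Longrightarrow> r1 u v = (if u < c then 0 else b)"
    and r2: "\<And>u v. u < v \<Longrightarrow> r2 u v = (if u < d then 0 else b)"
  shows "ereal \<bar>c - d\<bar> \<le> dmatch (diagram r1) (diagram r2)"
  unfolding dmatch_def
proof (rule INF_greatest, clarify)
  fix \<sigma> assume \<sigma>: "bij_betw \<sigma> (aug (diagram r1)) (aug (diagram r2))"
  let ?a = "((c, \<infinity>::ereal), 0::nat)"
  have a: "?a \<in> aug (diagram r1)"
    using mult_inf_const(1)[where r = r1 and c = c and b = b, OF r1] assms(1) by (simp add: aug_def diagram_simps)
  obtain x w i where s: "\<sigma> ?a = ((x, w), i)" by (metis prod.exhaust)
  have mem: "((x, w), i) \<in> aug (diagram r2)" using bij_betwE[OF \<sigma>] a s by metis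
  have "ereal \<bar>c - d\<bar> \<le> dstar (fst ?a) (fst (\<sigma> ?a))"
  proof (cases "w = \<infinity>")
    case True
    then have "mult_inf r2 x > 0" using mem by (auto simp: aug_def diagram_simps)
    then have "x = d" using mult_inf_const(2)[where r = r2 and c = d and b = b and u = x, OF r2] by auto
    then show ?thesis using s True by (simp add: dstar_def)
  next
    case False
    then show ?thesis using s by (cases w) (auto simp: dstar_def)
  qed
  also have "\<dots> \<le> (SUP a\<in>aug (diagram r1). dstar (fst a) (fst (\<sigma> a)))" by (rule SUP_upper[OF a])
  finally show "ereal \<bar>c - d\<bar> \<le> (SUP a\<in>aug (diagram r1). dstar (fst a) (fst (\<sigma> a)))" .
qed

section \<open>The natural pseudo-distance of a perception pair and the two inequalities\<close>

context
  fixes Phi :: "('x \<Rightarrow> real) set" and G :: "('x \<Rightarrow> 'x) set"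
  assumes pp: "perception_pair Phi G"
begin

lemma pp_bounded: "phi \<in> Phi \<Longrightarrow> bounded (range phi)"
  and pp_homeo: "g \<in> G \<Longrightarrow> Homeo_Phi Phi g"
  and pp_id: "id \<in> G"
  and pp_comp: "g \<in> G \<Longrightarrow> h \<in> G \<Longrightarrow> g \<circ> h \<in> G"
  and pp_inv: "g \<in> G \<Longrightarrow> inv g \<in> G"
  using pp by (auto simp: perception_pair_def)

lemma pp_bij: "g \<in> G \<Longrightarrow> bij g"
  and pp_act: "g \<in> G \<Longrightarrow> phi \<in> Phi \<Longrightarrow> phi \<circ> g \<in> Phi"
  using pp_homeo by (auto simp: Homeo_Phi_def)

lemma DPhi_nonneg: "phi1 \<in> Phi \<Longrightarrow> phi2 \<in> Phi \<Longrightarrow> 0 \<le> DPhi phi1 phi2"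
  using DPhi_upper[OF pp_bounded pp_bounded, of phi1 phi2 undefined] by linarith

lemma DPhi_triangle:
  assumes "phi1 \<in> Phi" "phi2 \<in> Phi" "phi3 \<in> Phi"
  shows "DPhi phi1 phi3 \<le> DPhi phi1 phi2 + DPhi phi2 phi3"
proof (rule DPhi_least)
  fix x
  show "\<bar>phi1 x - phi3 x\<bar> \<le> DPhi phi1 phi2 + DPhi phi2 phi3"
    using DPhi_upper[of phi1 phi2 x] DPhi_upper[of phi2 phi3 x] assms pp_bounded by fastforce
qed

lemma dG_lower: "phi1 \<in> Phi \<Longrightarrow> phi2 \<in> Phi \<Longrightarrow> g \<in> G \<Longrightarrow> dG Phi G phi1 phi2 \<le> DPhi phi1 (phi2 \<circ> g)"
  unfolding dG_def by (rule cINF_lower[OF bdd_belowI2[where m = 0]]) (auto intro: DPhi_nonneg pp_act)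

lemma dG_greatest: "(\<And>g. g \<in> G \<Longrightarrow> c \<le> DPhi phi1 (phi2 \<circ> g)) \<Longrightarrow> c \<le> dG Phi G phi1 phi2"
  unfolding dG_def using pp_id by (intro cINF_greatest) auto

lemma dG_nonneg: "phi1 \<in> Phi \<Longrightarrow> phi2 \<in> Phi \<Longrightarrow> 0 \<le> dG Phi G phi1 phi2"
  by (intro dG_greatest DPhi_nonneg pp_act)

lemma dG_self: "phi \<in> Phi \<Longrightarrow> dG Phi G phi phi = 0"
  using dG_lower[of phi phi id] dG_nonneg[of phi phi] pp_id DPhi_least[of phi phi 0] by force

text \<open>Composition with a group element only reparametrises the group over which the infimum
  runs. The inequality for \<open>g\<close> and for its inverse gives equality.\<close>

lemma dG_act:
  assumes "phi1 \<in> Phi" "phi2 \<in> Phi" "g \<in> G"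
  shows "dG Phi G (phi1 \<circ> g) phi2 = dG Phi G phi1 phi2"
proof -
  have le: "dG Phi G (phi \<circ> h) phi2 \<le> dG Phi G phi phi2" if "phi \<in> Phi" "h \<in> G" for phi h
  proof (rule dG_greatest)
    fix f assume f: "f \<in> G"
    have "dG Phi G (phi \<circ> h) phi2 \<le> DPhi (phi \<circ> h) (phi2 \<circ> (f \<circ> h))"
      by (intro dG_lower pp_act pp_comp) (use that f assms in auto)
    also have "\<dots> = DPhi phi (phi2 \<circ> f)"
      using DPhi_comp[of h phi "phi2 \<circ> f"] pp_bij[OF that(2)] by (simp add: o_assoc bij_is_surj)
    finally show "dG Phi G (phi \<circ> h) phi2 \<le> DPhi phi (phi2 \<circ> f)" .
  qed
  have "g \<circ> inv g = id" using pp_bij[OF assms(3)] bij_is_surj surj_iff by blast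
  then have "phi1 \<circ> g \<circ> inv g = phi1" by (simp add: o_assoc[symmetric])
  then show ?thesis
    using le[OF assms(1,3)] le[OF pp_act[OF assms(3,1)] pp_inv[OF assms(3)]] by simp
qed

lemma dG_lipschitz:
  assumes "phi1 \<in> Phi" "phi2 \<in> Phi" "phi \<in> Phi"
  shows "\<bar>dG Phi G phi1 phi - dG Phi G phi2 phi\<bar> \<le> DPhi phi1 phi2"
proof -
  have "dG Phi G a phi - DPhi a b \<le> dG Phi G b phi" if ab: "a \<in> Phi" "b \<in> Phi" for a b
  proof (rule dG_greatest)
    fix g assume g: "g \<in> G"
    show "dG Phi G a phi - DPhi a b \<le> DPhi b (phi \<circ> g)"
      using dG_lower[OF ab(1) assms(3) g] DPhi_triangle[OF ab pp_act[OF g assms(3)]] by linarith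
  qed
  moreover have "DPhi phi1 phi2 = DPhi phi2 phi1" by (simp add: DPhi_def abs_minus_commute)
  ultimately show ?thesis using assms by (smt (verit))
qed

text \<open>Non-negative functions differ by at most the larger of their values, so
  \<open>dG\<close> is at most one of the two sup norms and \<open>const\<close> puts the constant
  into \<open>Phi\<close>. Equivariance is \<open>dG_act\<close>, non-expansiveness is
  \<open>dG_lipschitz\<close>.\<close>

lemma GENEO_dG:
  assumes const: "\<forall>c::real. (\<exists>phi\<in>Phi. 0 \<le> c \<and> c \<le> supnorm phi) \<longrightarrow> (\<lambda>x. c) \<in> Phi"
    and nonneg: "\<forall>phi\<in>Phi. \<forall>x. 0 \<le> phi x" and phi: "phi \<in> Phi"
  shows "GENEO Phi G (\<lambda>psi x. dG Phi G psi phi)"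
  unfolding GENEO_def
proof (intro conjI ballI)
  fix psi assume psi: "psi \<in> Phi"
  have sn: "f x \<le> supnorm f" if "f \<in> Phi" for f x
    using DPhi_upper[OF pp_bounded[OF that], of "\<lambda>_. 0" x] by (simp add: DPhi_def supnorm_def)
  have "dG Phi G psi phi \<le> DPhi psi (phi \<circ> id)" by (rule dG_lower[OF psi phi pp_id])
  also have "\<dots> \<le> max (supnorm psi) (supnorm phi)"
  proof (rule DPhi_least)
    fix x
    show "\<bar>psi x - (phi \<circ> id) x\<bar> \<le> max (supnorm psi) (supnorm phi)"
      using sn[OF psi, of x] sn[OF phi, of x] nonneg[rule_format, OF psi, of x]
        nonneg[rule_format, OF phi, of x] by simp
  qed
  finally have "dG Phi G psi phi \<le> supnorm psi \<or> dG Phi G psi phi \<le> supnorm phi" by auto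
  then show "(\<lambda>x. dG Phi G psi phi) \<in> Phi"
    using dG_nonneg[OF psi phi] psi phi by (intro const[THEN spec, of "dG Phi G psi phi", THEN mp]) auto
  show "(\<lambda>x. dG Phi G (psi \<circ> g) phi) = (\<lambda>x. dG Phi G psi phi) \<circ> g" if "g \<in> G" for g
    using dG_act[OF psi phi that] by auto
  show "DPhi (\<lambda>x. dG Phi G psi phi) (\<lambda>x. dG Phi G psi' phi) \<le> DPhi psi psi'" if "psi' \<in> Phi" for psi'
    by (rule DPhi_least) (rule dG_lipschitz[OF psi that phi])
qed

text \<open>Equivariance moves \<open>g\<close> out of \<open>F\<close>, and ranks ignore it. What
  remains is a perturbation of size at most \<open>DPhi phi1 (phi2 \<circ> g)\<close>, which comes
  arbitrarily close to \<open>dG\<close>.\<close>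

lemma Dmatch_all_le:
  fixes TK :: "'k::field itself"
  assumes tame: "\<forall>psi\<in>Phi. \<forall>u v. u < v \<longrightarrow>
           cech_image_rank TK Phi k {x. psi x \<le> u} {x. psi x \<le> v} \<noteq> \<infinity>"
    and nonneg: "\<forall>phi\<in>Phi. \<forall>x. 0 \<le> phi x" and phi: "phi1 \<in> Phi" "phi2 \<in> Phi"
  shows "Dmatch_all TK Phi G k phi1 phi2 \<le> ereal (dG Phi G phi1 phi2)"
  unfolding Dmatch_all_def
proof (rule SUP_least, clarify)
  fix F assume F: "GENEO Phi G F"
  let ?d = "dmatch (diagram (pers_rank TK Phi k (F phi1))) (diagram (pers_rank TK Phi k (F phi2)))"
  have FPhi: "F phi \<in> Phi" if "phi \<in> Phi" for phi using F that by (simp add: GENEO_def)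
  show "?d \<le> ereal (dG Phi G phi1 phi2)"
  proof (rule ereal_le_epsilon2)
    fix e :: real assume "0 < e"
    then obtain g where g: "g \<in> G" "DPhi phi1 (phi2 \<circ> g) < dG Phi G phi1 phi2 + e"
      using dG_greatest[of "dG Phi G phi1 phi2 + e" phi1 phi2] by (meson not_le less_add_same_cancel1)
    have pg: "phi2 \<circ> g \<in> Phi" by (rule pp_act[OF g(1) phi(2)])
    have "DPhi (F phi1) (F (phi2 \<circ> g)) \<le> DPhi phi1 (phi2 \<circ> g)"
      using F phi pg by (simp add: GENEO_def)
    also note g(2)
    finally have "dmatch (diagram (pers_rank TK Phi k (F phi1)))
      (diagram (pers_rank TK Phi k (F (phi2 \<circ> g)))) \<le> ereal (dG Phi G phi1 phi2 + e)"
      by (intro pers_rank_stability[where \<epsilon> = "DPhi (F phi1) (F (phi2 \<circ> g))"] DPhi_upper)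
        (use tame nonneg FPhi[OF phi(1)] FPhi[OF pg] pp_bounded in auto)
    moreover have "F (phi2 \<circ> g) = F phi2 \<circ> g" using F phi g by (simp add: GENEO_def)
    ultimately show "?d \<le> ereal (dG Phi G phi1 phi2) + ereal e"
      by (simp add: pers_rank_homeo[OF pp_homeo[OF g(1)]])
  qed
qed

lemma dG_le_Dmatch_all:
  fixes TK :: "'k::field itself"
  assumes tame: "\<forall>psi\<in>Phi. \<forall>u v. u < v \<longrightarrow>
           cech_image_rank TK Phi k {x. psi x \<le> u} {x. psi x \<le> v} \<noteq> \<infinity>"
    and nonneg: "\<forall>phi\<in>Phi. \<forall>x. 0 \<le> phi x"
    and betti: "cech_image_rank TK Phi k UNIV UNIV \<noteq> 0"
    and const: "\<forall>c::real. (\<exists>phi\<in>Phi. 0 \<le> c \<and> c \<le> supnorm phi) \<longrightarrow> (\<lambda>x. c) \<in> Phi"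
    and phi: "phi1 \<in> Phi" "phi2 \<in> Phi"
  shows "ereal (dG Phi G phi1 phi2) \<le> Dmatch_all TK Phi G k phi1 phi2"
proof -
  define F where "F = (\<lambda>psi (x::'x). dG Phi G psi phi2)"
  have F: "GENEO Phi G F" unfolding F_def by (rule GENEO_dG[OF const nonneg phi(2)])
  have "F phi2 \<in> Phi" using F phi by (simp add: GENEO_def)
  \<comment> \<open>\<open>F phi2\<close> is a constant function in \<open>Phi\<close>; at its value
    and above, both sublevel sets are the whole space, so the finiteness assumption covers the Betti
    number itself.\<close>
  then have "cech_image_rank TK Phi k UNIV UNIV \<noteq> \<infinity>"
    using tame[rule_format, of "F phi2" "dG Phi G phi2 phi2" "dG Phi G phi2 phi2 + 1"] by (simp add: F_def)
  then obtain b where b: "cech_image_rank TK Phi k UNIV UNIV = enat b" by auto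
  have "0 < b" using betti b by (cases b) (auto simp: zero_enat_def)
  have r: "pers_rank TK Phi k (\<lambda>x. c) u v = (if u < c then 0 else b)" if "u < v" for c u v
    using that b cech_image_rank_empty[of TK Phi k]
    by (auto simp: pers_rank_def not_less zero_enat_def)
  have "ereal (dG Phi G phi1 phi2) = ereal \<bar>dG Phi G phi1 phi2 - dG Phi G phi2 phi2\<bar>"
    using dG_self dG_nonneg phi by simp
  also have "\<dots> \<le> dmatch (diagram (pers_rank TK Phi k (F phi1))) (diagram (pers_rank TK Phi k (F phi2)))"
    unfolding F_def by (rule dmatch_const[OF \<open>0 < b\<close> r r])
  also have "\<dots> \<le> Dmatch_all TK Phi G k phi1 phi2"
    unfolding Dmatch_all_def by (rule SUP_upper) (use F in auto)
  finally show ?thesis .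
qed

end

theorem mainTheorem15:
  fixes Phi :: "('x \<Rightarrow> real) set" and G :: "('x \<Rightarrow> 'x) set" and k :: nat
    and TK :: "'k::field itself"
  assumes "perception_pair Phi G"
    and "\<forall>psi\<in>Phi. \<forall>u v. u < v \<longrightarrow>
           cech_image_rank TK Phi k {x. psi x \<le> u} {x. psi x \<le> v} \<noteq> \<infinity>"
    and "\<forall>phi\<in>Phi. \<forall>x. 0 \<le> phi x"
    and "cech_image_rank TK Phi k UNIV UNIV \<noteq> 0"
    and "\<forall>c::real. (\<exists>phi\<in>Phi. 0 \<le> c \<and> c \<le> supnorm phi) \<longrightarrow> (\<lambda>x. c) \<in> Phi"
    and "phi1 \<in> Phi" and "phi2 \<in> Phi"
  shows "Dmatch_all TK Phi G k phi1 phi2 = ereal (dG Phi G phi1 phi2)"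
  by (rule antisym[OF Dmatch_all_le[OF assms(1-3,6,7)] dG_le_Dmatch_all[OF assms]])

end
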